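(* Let $k$ and $\ell$ be two positive integers such that $k\ge\max\{\ell,3\}$, and let $D$ be a strongly connected digraph that contains no subdivision of $C(k,\ell)$ as a subdigraph. Then $$\chi(D)\le (k+\ell-2)(k+\ell-3)(2\ell+2)(k+\ell+1).$$
   Context: Digraphs are finite, without loops or parallel arcs (two opposite arcs between the same two vertices are allowed). The chromatic number $\chi(D)$ of a digraph $D$ is the chromatic number of its underlying undirected graph. $C(k,\ell)$ is the oriented cycle with two blocks, one of length $k$ and the other of length $\ell$: it is the union of two internally disjoint directed paths with the same initial vertex and the same terminal vertex (distinct from the initial vertex), one of length $k$ and one of length $\ell$. A subdivision of a digraph $F$ is obtained from $F$ by replacing each arc $uv$ by a directed $(u,v)$-path of length at least $1$, these paths being pairwise internally disjoint with new internal vertices. *)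

theory Defs
  imports "Graph_Theory.Kuratowski"
begin

section \<open>Chromatic number\<close>

definition proper_colouring :: "('a, 'b) pre_digraph \<Rightarrow> nat \<Rightarrow> ('a \<Rightarrow> nat) \<Rightarrow> bool" where
  "proper_colouring G n c \<longleftrightarrow>
     (\<forall>v \<in> verts G. c v < n) \<and> (\<forall>u v. u \<rightarrow>\<^bsub>G\<^esub> v \<longrightarrow> c u \<noteq> c v)"

text \<open>Undirected graphs are represented, as in the imported library, by symmetric digraphs.\<close>

definition chromatic_number :: "('a, 'b) pre_digraph \<Rightarrow> nat" where
  "chromatic_number G = (LEAST n. \<exists>c. proper_colouring G n c)"

definition digraph_chromatic_number :: "('a, 'b) pre_digraph \<Rightarrow> nat" where
  "digraph_chromatic_number D = chromatic_number (with_proj (mk_symmetric D))"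

text \<open>
  The \<open>LEAST\<close> above ranges over a nonempty set as soon as \<open>D\<close> is finite and loopless.
\<close>

lemma (in digraph) ex_proper_colouring:
  "\<exists>n c. proper_colouring (with_proj (mk_symmetric G)) n c"
proof -
  obtain c where c: "bij_betw c (verts G) {0..<card (verts G)}"
    using ex_bij_betw_finite_nat finite_verts by blast
  have "proper_colouring (with_proj (mk_symmetric G)) (card (verts G)) c"
    unfolding proper_colouring_def
  proof (intro conjI ballI allI impI)
    fix v assume "v \<in> verts (with_proj (mk_symmetric G))"
    then show "c v < card (verts G)" using c by (auto dest: bij_betwE)
  next
    fix u v assume "u \<rightarrow>\<^bsub>with_proj (mk_symmetric G)\<^esub> v"
    then have "u \<in> verts G" "v \<in> verts G" "u \<noteq> v"
      by (auto simp: parcs_mk_symmetric dest: no_loops)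
    then show "c u \<noteq> c v" using c by (auto simp: bij_betw_def dest: inj_onD)
  qed
  then show ?thesis by blast
qed


section \<open>Subdivisions of digraphs\<close>

text \<open>
  The subdivision relation of the imported library concerns bidirected digraphs only.
  Here \<open>f\<close> embeds the vertices of \<open>F\<close> and \<open>P e\<close> is the directed path that replaces the arc \<open>e\<close>.
  By definition, \<^term>\<open>pre_digraph.gen_iapath H V u p v\<close> says that \<open>p\<close> is a nonempty directed path
  of \<open>H\<close> without repeated vertices from \<open>u \<in> V\<close> to \<open>v \<in> V\<close> with no inner vertex in \<open>V\<close>.
\<close>

definition is_subdivision_of :: "('a, 'b) pre_digraph \<Rightarrow> ('c, 'd) pre_digraph \<Rightarrow> bool" where
  "is_subdivision_of H F \<longleftrightarrow>
     (\<exists>f P. inj_on f (verts F) \<and>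
        (\<forall>e \<in> arcs F.
           pre_digraph.gen_iapath H (f ` verts F) (f (tail F e)) (P e) (f (head F e))) \<and>
        (\<forall>e \<in> arcs F. \<forall>e' \<in> arcs F. e \<noteq> e' \<longrightarrow>
           set (pre_digraph.inner_verts H (P e)) \<inter> set (pre_digraph.inner_verts H (P e')) = {}) \<and>
        verts H = f ` verts F \<union> (\<Union>e \<in> arcs F. set (pre_digraph.inner_verts H (P e))) \<and>
        arcs H = (\<Union>e \<in> arcs F. set (P e)))"

definition contains_subdivision_of :: "('a, 'b) pre_digraph \<Rightarrow> ('c, 'd) pre_digraph \<Rightarrow> bool" where
  "contains_subdivision_of D F \<longleftrightarrow> (\<exists>H. subgraph H D \<and> is_subdivision_of H F)"


section \<open>Oriented cycles with two blocks\<close>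

text \<open>
  The cycle on \<open>0, \<dots>, k + l - 1\<close>, in this cyclic order, whose edges are oriented so that
  \<open>0 \<rightarrow> 1 \<rightarrow> \<dots> \<rightarrow> k\<close> is the block of length \<open>k\<close> and
  \<open>0 \<rightarrow> k + l - 1 \<rightarrow> \<dots> \<rightarrow> k + 1 \<rightarrow> k\<close> is the block of length \<open>l\<close>.
  For \<open>k = l = 1\<close> the two blocks would be parallel arcs and they are identified here; the
  definition is meant for \<open>k, l \<ge> 1\<close> with \<open>k + l \<ge> 3\<close>.
\<close>

definition two_block_cycle :: "nat \<Rightarrow> nat \<Rightarrow> nat pair_pre_digraph" where
  "two_block_cycle k l =
     \<lparr> pverts = {0..<k + l},
       parcs = {(i, Suc i) | i. i < k} \<union> {(Suc i mod (k + l), i) | i. k \<le> i \<and> i < k + l} \<rparr>"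

lemma digraph_two_block_cycle:
  assumes "1 \<le> k" "1 \<le> l" "3 \<le> k + l"
  shows "digraph (with_proj (two_block_cycle k l))"
proof -
  have "finite {(i, Suc i) | i. i < k}"
    "finite {(Suc i mod (k + l), i) | i. k \<le> i \<and> i < k + l}"
    by (auto intro: finite_image_set)
  moreover have "Suc i mod (k + l) \<noteq> i" if "i < k + l" for i
    using assms that by (cases "Suc i = k + l") auto
  ultimately show ?thesis
    using assms
    by unfold_locales
      (auto simp: two_block_cycle_def arc_to_ends_def intro!: mod_less_divisor)
qed

lemma two_block_cycle_union_of_paths:
  assumes "1 \<le> k" "1 \<le> l"
  defines "C \<equiv> with_proj (two_block_cycle k l)"
  obtains p q where
    "pre_digraph.apath C 0 p k" "length p = k"
    "pre_digraph.apath C 0 q k" "length q = l"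
    "set (pre_digraph.inner_verts C p) \<inter> set (pre_digraph.inner_verts C q) = {}"
    "verts C = set (pre_digraph.awalk_verts C 0 p) \<union> set (pre_digraph.awalk_verts C 0 q)"
    "arcs C = set p \<union> set q"
proof -
  define p where "p = map (\<lambda>i. (i, Suc i)) [0..<k]"
  define q where "q = map (\<lambda>i. (Suc i mod (k + l), i)) (rev [k..<k + l])"
  have arcs: "arcs C = set p \<union> set q"
    by (auto simp: C_def two_block_cycle_def p_def q_def)
  have ne: "p \<noteq> []" "q \<noteq> []" using assms by (auto simp: p_def q_def)
  have p_walk: "pcas a (map (\<lambda>i. (i, Suc i)) [a..<b]) b"
    "pawalk_verts a (map (\<lambda>i. (i, Suc i)) [a..<b]) = [a..<Suc b]" if "a \<le> b" for a b
    using that by (induction a rule: inc_induct) (simp_all add: upt_conv_Cons del: upt_Suc)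
  have q_walk: "pcas (Suc m mod N) (map (\<lambda>i. (Suc i mod N, i)) (rev [k..<Suc m])) k"
    "pawalk_verts x (map (\<lambda>i. (Suc i mod N, i)) (rev [k..<Suc m])) = (Suc m mod N) # rev [k..<Suc m]"
    if "k \<le> m" "m < N" for m N x
    using that
  proof (induction m arbitrary: x rule: dec_induct)
    case (step m)
    {
      case 1
      then have "Suc m mod N = Suc m" by simp
      with step.IH(1) step.hyps 1 show ?case by simp
    next
      case 2
      then have "Suc m mod N = Suc m" by simp
      with step.IH(2) step.hyps 2 show ?case by simp
    }
  qed simp_all
  have Suc_last: "Suc (k + l - 1) = k + l" using assms by simp
  have vp: "pawalk_verts 0 p = [0..<Suc k]" and cp: "pcas 0 p k"
    using p_walk[of 0 k] by (simp_all add: p_def del: upt_Suc)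
  have vq: "pawalk_verts 0 q = 0 # rev [k..<k + l]" and cq: "pcas 0 q k"
    using q_walk(1)[of "k + l - 1" "k + l"] q_walk(2)[of "k + l - 1" "k + l" 0] assms(1,2)
    unfolding Suc_last by (simp_all add: q_def)
  have inner: "pre_digraph.inner_verts C r = tl (butlast (pawalk_verts 0 r))" if "r \<noteq> []" for r
    using that pre_digraph.awalk_verts_conv[of C 0 r]
    by (simp add: C_def pre_digraph.inner_verts_def awalk_verts_with_proj_eq)
  have "[k..<k + l] = k # [Suc k..<k + l]" using assms by (simp add: upt_conv_Cons)
  then have inner_q: "pre_digraph.inner_verts C q = rev [Suc k..<k + l]"
    by (simp add: inner ne vq butlast_append)
  have inner_p: "pre_digraph.inner_verts C p = [1..<k]"
    using assms(1) by (simp add: inner ne vp upt_conv_Cons[of 0 k])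
  show ?thesis
  proof
    show "pre_digraph.apath C 0 p k" "pre_digraph.apath C 0 q k"
      using arcs assms(1,2) cp cq vp vq
      by (auto simp: pre_digraph.apath_def pre_digraph.awalk_def C_def cas_with_proj_eq
          awalk_verts_with_proj_eq two_block_cycle_def)
    show "length p = k" "length q = l" by (simp_all add: p_def q_def)
    show "set (pre_digraph.inner_verts C p) \<inter> set (pre_digraph.inner_verts C q) = {}"
      by (auto simp: inner_p inner_q)
    show "verts C = set (pre_digraph.awalk_verts C 0 p) \<union> set (pre_digraph.awalk_verts C 0 q)"
      using assms(1,2) vp vq
      by (auto simp: C_def awalk_verts_with_proj_eq two_block_cycle_def simp del: upt_Suc)
    show "arcs C = set p \<union> set q" by (fact arcs)
  qed
qed

end

theory Submission
  imports Defs
begin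

text \<open>
  A subdivision of \<open>C(k, l)\<close> is a spindle: two internally disjoint directed paths with common
  ends, one with at least \<open>k\<close> and the other with at least \<open>l\<close> arcs
  (\<open>spindle_contains_subdivision\<close>). So the theorem says that a strong relation \<open>E\<close> without
  spindles can be coloured with few colours (\<open>strong_spindle_free_colouring\<close>).

  Let \<open>L = 2 k - 1\<close>. If no directed cycle had length at least \<open>L\<close>, then Bondy's theorem
  (\<open>bondy\<close>) would give \<open>2 k - 2\<close> colours. In general the long cycles are packed first: again and
  again a longest cycle is chosen among those that meet every component of the union \<open>K\<close> of the
  cycles chosen before in at most one vertex, as long as its length is at least \<open>L\<close>. The components
  of the final \<open>K\<close> are cactuses of directed cycles. The order of the choices matters. Suppose that
  contracting the components left a cycle of length at least \<open>L\<close>, lift it to a cycle \<open>W\<close> of \<open>E\<close>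
  that runs along \<open>K\<close> inside the components, and let \<open>Z\<close> be the first chosen cycle that shares an
  arc with \<open>W\<close>. When \<open>Z\<close> was chosen, \<open>W\<close> was a candidate too, so \<open>W\<close> is not longer than \<open>Z\<close>.
  Outside their common part \<open>W\<close> is long, hence \<open>Z\<close> is at least as long there, and the two
  remaining parts are a spindle. If there is no such \<open>Z\<close>, then \<open>W\<close> could still have been chosen. So
  Bondy's theorem colours the components with \<open>2 k - 2\<close> colours, such that arcs between different
  components are properly coloured (\<open>greedy_rigid\<close>, \<open>quotient_has_no_long_cycle\<close>).

  There remain the arcs inside a component (\<open>rooted_cactus.colouring\<close>). Root it; then every other
  vertex has a depth, and lies on exactly one cycle that has a vertex closer to the root, its top.
  Walking around cycles of length at least \<open>2 k - 1\<close> gives one long way in one of the two directions,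
  and from this spindles arise unless an arc is placed in a very restricted way:

  \<^item> its ends differ in depth by at most \<open>l\<close>, so that \<open>l + 1\<close> colours separate different depths;
  \<^item> if its ends have equal depth but lie on different cycles, then exactly one of them is
    less than \<open>l\<close> steps after the top of its cycle, so that two colours are enough for these arcs;
  \<^item> if its ends lie on the same cycle, then it is a chord of a path, and two chords whose ends all
    have the same position modulo \<open>k\<close> do not cross. Graphs without crossing chords have
    three-colourings, so \<open>3 k\<close> colours are enough.

  The product is below the bound if \<open>l \<ge> 2\<close>. If \<open>l = 1\<close>, the second kind of arc does not exist and
  the third kind needs only \<open>2 k - 1\<close> colours, which gives the bound again, with equality for
  \<open>k = 3\<close>.
\<close>

section \<open>Walks as vertex lists\<close>

definition walk :: "('v \<times> 'v) set \<Rightarrow> 'v list \<Rightarrow> bool" where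
  "walk E p \<longleftrightarrow> p \<noteq> [] \<and> successively (\<lambda>a b. (a, b) \<in> E) p"

definition dpath :: "('v \<times> 'v) set \<Rightarrow> 'v list \<Rightarrow> bool" where
  "dpath E p \<longleftrightarrow> walk E p \<and> distinct p"

definition dcycle :: "('v \<times> 'v) set \<Rightarrow> 'v list \<Rightarrow> bool" where
  "dcycle E p \<longleftrightarrow> dpath E p \<and> (last p, hd p) \<in> E"

lemma walk_not_Nil [simp]: "walk E p \<Longrightarrow> p \<noteq> []"
  by (simp add: walk_def)

lemma walk_Nil [simp]: "\<not> walk E []"
  by (simp add: walk_def)

lemma walk_singleton [simp]: "walk E [x]"
  by (simp add: walk_def)

lemma walk_Cons: "p \<noteq> [] \<Longrightarrow> walk E (x # p) \<longleftrightarrow> (x, hd p) \<in> E \<and> walk E p"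
  by (auto simp: walk_def successively_Cons)

lemma walk_append:
  "p \<noteq> [] \<Longrightarrow> q \<noteq> [] \<Longrightarrow>
    walk E (p @ q) \<longleftrightarrow> walk E p \<and> walk E q \<and> (last p, hd q) \<in> E"
  by (auto simp: walk_def successively_append_iff)

lemma walk_nth: "walk E p \<longleftrightarrow> p \<noteq> [] \<and> (\<forall>i. Suc i < length p \<longrightarrow> (p ! i, p ! Suc i) \<in> E)"
proof (induction p rule: induct_list012)
  case (3 x y p)
  then show ?case
    by (auto simp: walk_Cons nth_Cons split: nat.splits)
qed auto

lemma walk_mono: "walk E p \<Longrightarrow> E \<subseteq> F \<Longrightarrow> walk F p"
  by (auto simp: walk_def intro: successively_mono)

lemma walk_appendD1: "walk E (p @ q) \<Longrightarrow> p \<noteq> [] \<Longrightarrow> walk E p"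
  by (auto simp: walk_def successively_append_iff)

lemma walk_appendD2: "walk E (p @ q) \<Longrightarrow> q \<noteq> [] \<Longrightarrow> walk E q"
  by (auto simp: walk_def successively_append_iff)

lemma dpath_append:
  "p \<noteq> [] \<Longrightarrow> q \<noteq> [] \<Longrightarrow>
    dpath E (p @ q) \<longleftrightarrow> dpath E p \<and> dpath E q \<and> (last p, hd q) \<in> E \<and> set p \<inter> set q = {}"
  by (auto simp: dpath_def walk_append)

lemma dpath_Cons:
  "p \<noteq> [] \<Longrightarrow> dpath E (x # p) \<longleftrightarrow> dpath E p \<and> (x, hd p) \<in> E \<and> x \<notin> set p"
  by (auto simp: dpath_def walk_Cons)

lemma dpath_not_Nil: "dpath E p \<Longrightarrow> p \<noteq> []"
  by (auto simp: dpath_def)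

lemma walk_imp_rtrancl: "walk E p \<Longrightarrow> x \<in> set p \<Longrightarrow> (hd p, x) \<in> E\<^sup>*"
proof (induction p)
  case (Cons a p)
  then show ?case
    by (cases "p = []") (auto simp: walk_Cons intro: converse_rtrancl_into_rtrancl)
qed simp

lemma rtrancl_imp_dpath:
  assumes "(u, v) \<in> R\<^sup>*"
  obtains p where "dpath R p" "hd p = u" "last p = v"
proof -
  have "\<exists>p. dpath R p \<and> hd p = u \<and> last p = v"
    using assms
  proof (induction rule: converse_rtrancl_induct)
    case base
    show ?case by (rule exI[of _ "[v]"]) (simp add: dpath_def)
  next
    case (step x y)
    then obtain p where p: "dpath R p" "hd p = y" "last p = v" by blast
    show ?case
    proof (cases "x \<in> set p")
      case True
      then obtain as bs where "p = as @ x # bs" by (meson split_list)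
      with p show ?thesis
        by (intro exI[of _ "x # bs"]) (auto simp: dpath_def dest: walk_appendD2)
    next
      case False
      with p step show ?thesis
        by (intro exI[of _ "x # p"]) (auto simp: dpath_def walk_Cons)
    qed
  qed
  then show ?thesis using that by blast
qed

section \<open>Strong digraphs without long cycles\<close>

fun wt :: "('v \<times> 'v \<Rightarrow> nat) \<Rightarrow> 'v list \<Rightarrow> nat" where
  "wt w (x # y # p) = w (x, y) + wt w (y # p)"
| "wt w p = 0"

lemma wt_append:
  "p \<noteq> [] \<Longrightarrow> q \<noteq> [] \<Longrightarrow> wt w (p @ q) = wt w p + w (last p, hd q) + wt w q"
proof (induction p rule: induct_list012)
  case (2 x)
  then show ?case by (cases q) simp_all
qed simp_all

text \<open>
  A closed walk is given by the list of its vertices without repeating the first one, so that its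
  last arc leads from the last to the first element of the list.
\<close>

definition positive_weighting :: "('v \<times> 'v) set \<Rightarrow> ('v \<times> 'v \<Rightarrow> nat) \<Rightarrow> bool" where
  "positive_weighting A w \<longleftrightarrow>
     (\<forall>p. walk A p \<longrightarrow> (last p, hd p) \<in> A \<longrightarrow> 1 \<le> wt w p + w (last p, hd p))"

text \<open>
  The walks \<open>p\<close> below lead from the head of \<open>e\<close> back to its tail, so this is the least weight of a
  closed walk through \<open>e\<close>.
\<close>

definition min_closed :: "('v \<times> 'v) set \<Rightarrow> ('v \<times> 'v \<Rightarrow> nat) \<Rightarrow> 'v \<times> 'v \<Rightarrow> nat" where
  "min_closed A w e = (LEAST n. \<exists>p. walk A p \<and> hd p = snd e \<and> last p = fst e \<and> n = wt w p + w e)"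

lemma min_closed_le:
  "walk A p \<Longrightarrow> hd p = y \<Longrightarrow> last p = x \<Longrightarrow> min_closed A w (x, y) \<le> wt w p + w (x, y)"
  unfolding min_closed_def by (rule Least_le) auto

lemma min_closed_attained:
  assumes "(y, x) \<in> A\<^sup>*"
  obtains p where "walk A p" "hd p = y" "last p = x" "min_closed A w (x, y) = wt w p + w (x, y)"
proof -
  have "\<exists>n p. walk A p \<and> hd p = snd (x, y) \<and> last p = fst (x, y) \<and> n = wt w p + w (x, y)"
    using rtrancl_imp_dpath[OF assms] by (auto simp: dpath_def)
  from LeastI_ex[OF this] that show ?thesis
    unfolding min_closed_def by auto
qed

text \<open>
  The distance \<open>d\<close> from \<open>y\<close> serves as a potential. Adding its differences to the weights
  does not change the weight of any closed walk, but it moves the whole weight of a cheapest closed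
  walk through \<open>(x, y)\<close> onto the arc \<open>(x, y)\<close>. As this weight is at least two, it can then be
  lowered by one without destroying positivity.
\<close>

lemma reweighting:
  assumes pos: "positive_weighting A w"
    and strong: "\<And>u v. u \<in> Field A \<Longrightarrow> v \<in> Field A \<Longrightarrow> (u, v) \<in> A\<^sup>*"
    and xy: "(x, y) \<in> A" and big: "2 \<le> min_closed A w (x, y)"
  obtains w' where "positive_weighting A w'"
    "\<And>e. e \<in> A \<Longrightarrow> min_closed A w' e \<le> min_closed A w e"
    "min_closed A w' (x, y) < min_closed A w (x, y)"
proof -
  define d where "d v = (LEAST n. \<exists>p. walk A p \<and> hd p = y \<and> last p = v \<and> n = wt w p)" for v
  have d_le: "d (last p) \<le> wt w p" if "walk A p" "hd p = y" for p
    unfolding d_def by (rule Least_le) (use that in auto)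
  have d_att: "\<exists>p. walk A p \<and> hd p = y \<and> last p = v \<and> d v = wt w p" if v: "v \<in> Field A" for v
  proof -
    have "(y, v) \<in> A\<^sup>*" using strong xy v by (auto simp: Field_def)
    then have "\<exists>n p. walk A p \<and> hd p = y \<and> last p = v \<and> n = wt w p"
      using rtrancl_imp_dpath[of y v A] by (auto simp: dpath_def)
    from LeastI_ex[OF this] show ?thesis unfolding d_def by blast
  qed
  have d_y: "d y = 0" using d_le[of "[y]"] by simp
  have tri: "d v \<le> d u + w (u, v)" if uv: "(u, v) \<in> A" for u v
  proof -
    obtain p where "walk A p" "hd p = y" "last p = u" "d u = wt w p"
      using d_att[of u] uv by (auto simp: Field_def)
    then show ?thesis using d_le[of "p @ [v]"] uv by (simp add: walk_append wt_append)
  qed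
  \<comment> \<open>By \<open>tri\<close>, the subtraction is not truncated on the arcs of \<open>A\<close>.\<close>
  define w1 where "w1 e = w e + d (fst e) - d (snd e)" for e
  define w2 where "w2 = w1((x, y) := w1 (x, y) - 1)"
  have tele: "wt w1 p + d (last p) = wt w p + d (hd p)" if "walk A p" for p
    using that
  proof (induction p rule: induct_list012)
    case (3 a b p)
    then show ?case using tri[of a b] by (auto simp: walk_Cons w1_def)
  qed auto
  have closed: "wt w1 p + w1 (last p, hd p) = wt w p + w (last p, hd p)"
    if "walk A p" "(last p, hd p) \<in> A" for p
    using tele[OF that(1)] tri[OF that(2)] by (simp add: w1_def)
  obtain p where p: "walk A p" "hd p = y" "last p = x" "min_closed A w (x, y) = wt w p + w (x, y)"
    using min_closed_attained[OF strong[of y x]] xy by (metis FieldI1 FieldI2)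
  obtain q where q: "walk A q" "hd q = y" "last q = x" "d x = wt w q"
    using d_att[of x] xy by (auto simp: Field_def)
  have w1_big: "2 \<le> w1 (x, y)"
    using min_closed_le[OF q(1-3), of w] big d_y q(4) by (simp add: w1_def)
  have w2_le: "w2 e \<le> w1 e" for e by (simp add: w2_def)
  have wt_w2_le: "wt w2 p \<le> wt w1 p" for p
    by (induction p rule: induct_list012) (auto intro: add_mono w2_le)
  \<comment> \<open>A walk that uses \<open>(x, y)\<close> keeps positive weight; on the others \<open>w2\<close> agrees with \<open>w1\<close>.\<close>
  have w2_cases: "wt w2 p = wt w1 p \<or> 1 \<le> wt w2 p" for p
  proof (induction p rule: induct_list012)
    case (3 a b p)
    then show ?case using w1_big by (auto simp: w2_def)
  qed auto
  have pos2: "positive_weighting A w2"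
    unfolding positive_weighting_def
  proof (intro allI impI)
    fix p assume p: "walk A p" "(last p, hd p) \<in> A"
    have "1 \<le> wt w p + w (last p, hd p)"
      using pos p by (auto simp: positive_weighting_def)
    then show "1 \<le> wt w2 p + w2 (last p, hd p)"
      using closed[OF p] w2_cases[of p] w1_big by (auto simp: w2_def)
  qed
  have mono: "min_closed A w2 (a, b) \<le> min_closed A w (a, b)" if ab: "(a, b) \<in> A" for a b
  proof -
    obtain p where p: "walk A p" "hd p = b" "last p = a"
      "min_closed A w (a, b) = wt w p + w (a, b)"
      using min_closed_attained[OF strong[of b a]] ab by (metis FieldI1 FieldI2)
    show ?thesis
      using min_closed_le[OF p(1-3), of w2] closed[OF p(1)] p ab wt_w2_le[of p] w2_le[of "(a, b)"]
      by simp
  qed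
  have "min_closed A w2 (x, y) < min_closed A w (x, y)"
    using min_closed_le[OF p(1-3), of w2] closed[OF p(1)] p xy wt_w2_le[of p] w1_big
    by (simp add: w2_def)
  with pos2 mono show ?thesis using that by force
qed

text \<open>
  Minimising the sum of \<^const>\<open>min_closed\<close> over all arcs gives a weighting in which every
  arc lies on a closed walk of weight one. It takes the part of the coherent cyclic orders of Bessy
  and Thomasse; the weight of a closed walk corresponds to the number of times that it winds around.
\<close>

lemma coherent_weighting:
  assumes fin: "finite A"
    and strong: "\<And>u v. u \<in> Field A \<Longrightarrow> v \<in> Field A \<Longrightarrow> (u, v) \<in> A\<^sup>*"
  obtains w where "positive_weighting A w"
    "\<And>x y. (x, y) \<in> A \<Longrightarrow> \<exists>p. walk A p \<and> hd p = y \<and> last p = x \<and> wt w p + w (x, y) = 1"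
proof -
  define \<mu> where "\<mu> w = (\<Sum>e\<in>A. min_closed A w e)" for w
  have "positive_weighting A (\<lambda>_. 1)"
    by (auto simp: positive_weighting_def)
  then obtain w where w: "positive_weighting A w"
    and least: "\<And>w'. positive_weighting A w' \<Longrightarrow> \<mu> w \<le> \<mu> w'"
    using ex_has_least_nat[of "positive_weighting A" "\<lambda>_. 1" \<mu>] by blast
  have "\<exists>p. walk A p \<and> hd p = y \<and> last p = x \<and> wt w p + w (x, y) = 1" if xy: "(x, y) \<in> A" for x y
  proof -
    have "\<not> 2 \<le> min_closed A w (x, y)"
    proof
      assume "2 \<le> min_closed A w (x, y)"
      from reweighting[OF w strong xy this] obtain w' where w': "positive_weighting A w'"
        "\<And>e. e \<in> A \<Longrightarrow> min_closed A w' e \<le> min_closed A w e"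
        "min_closed A w' (x, y) < min_closed A w (x, y)" by blast
      then have "\<mu> w' < \<mu> w"
        unfolding \<mu>_def using xy by (intro sum_strict_mono_ex1 fin) auto
      with least[OF w'(1)] show False by simp
    qed
    moreover obtain p where p: "walk A p" "hd p = y" "last p = x"
      "min_closed A w (x, y) = wt w p + w (x, y)"
      using min_closed_attained[OF strong[of y x]] xy by (metis FieldI1 FieldI2)
    moreover have "1 \<le> wt w p + w (x, y)"
      using w p xy unfolding positive_weighting_def by metis
    ultimately show ?thesis by (intro exI[of _ p]) linarith
  qed
  with w show ?thesis using that by blast
qed

text \<open>
  Take a coherent weighting \<open>w\<close>. A cycle has length at most \<open>K\<close> and weight at least one, so giving
  every arc the value \<open>1 - K w\<close> makes no cycle positive. Therefore the largest
  value \<open>c v\<close> of a path that ends in \<open>v\<close> satisfies \<open>c y - c x \<ge> 1 - K w (x, y)\<close> for every arc.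
  Summing this over the rest of a closed walk of weight one gives an estimate in the other
  direction, and together they say that the two ends of an arc have different values modulo \<open>K\<close>.
\<close>

lemma bondy:
  assumes fin: "finite A"
    and strong: "\<And>u v. u \<in> Field A \<Longrightarrow> v \<in> Field A \<Longrightarrow> (u, v) \<in> A\<^sup>*"
    and irrefl: "\<And>x. (x, x) \<notin> A"
    and short: "\<And>p. dcycle A p \<Longrightarrow> length p \<le> K" and K: "0 < K"
  obtains c :: "'v \<Rightarrow> nat" where "\<And>v. c v < K" "\<And>x y. (x, y) \<in> A \<Longrightarrow> c x \<noteq> c y"
proof -
  obtain w where w: "positive_weighting A w"
    and coh: "\<And>x y. (x, y) \<in> A \<Longrightarrow>
      \<exists>p. walk A p \<and> hd p = y \<and> last p = x \<and> wt w p + w (x, y) = 1"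
    using coherent_weighting[OF fin strong] by blast
  \<comment> \<open>The number of arcs of \<open>p\<close> is \<open>length p - 1\<close>.\<close>
  define val :: "'v list \<Rightarrow> int" where
    "val p = int (length p) - 1 - int K * int (wt w p)" for p
  define c where "c v = Max {val p | p. dpath A p \<and> last p = v}" for v
  have fin_paths: "finite {val p | p. dpath A p \<and> last p = v}" for v
  proof -
    have "set p \<subseteq> insert v (Field A)" if "walk A p" "last p = v" for p
      using that
    proof (induction p)
      case (Cons a p)
      then show ?case by (cases "p = []") (auto simp: walk_Cons Field_def)
    qed simp
    then have "{p. dpath A p \<and> last p = v} \<subseteq> {p. set p \<subseteq> insert v (Field A) \<and> distinct p}"
      by (auto simp: dpath_def)
    moreover have "finite {p. set p \<subseteq> insert v (Field A) \<and> distinct p}"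
      using fin by (intro finite_subset_distinct) (simp add: finite_Field)
    ultimately have "finite {p. dpath A p \<and> last p = v}" by (rule finite_subset)
    then show ?thesis by simp
  qed
  have c_ge: "val p \<le> c v" if "dpath A p" "last p = v" for p v
    unfolding c_def by (rule Max_ge[OF fin_paths]) (use that in auto)
  have c_att: "\<exists>p. dpath A p \<and> last p = v \<and> c v = val p" for v
  proof -
    have "val [v] \<in> {val p | p. dpath A p \<and> last p = v}"
      by (intro CollectI exI[of _ "[v]"]) (simp add: dpath_def)
    then have "c v \<in> {val p | p. dpath A p \<and> last p = v}"
      unfolding c_def by (intro Max_in[OF fin_paths]) blast
    then show ?thesis by blast
  qed
  have step: "c x + 1 - int K * int (w (x, y)) \<le> c y" if xy: "(x, y) \<in> A" for x y
  proof -
    obtain p where p: "dpath A p" "last p = x" "c x = val p" using c_att by blast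
    have ne: "p \<noteq> []" using p(1) by (auto simp: dpath_def)
    show ?thesis
    proof (cases "y \<in> set p")
      case False
      then have "dpath A (p @ [y])" using p xy ne by (auto simp: dpath_def walk_append)
      from c_ge[OF this, of y] show ?thesis
        using p ne by (simp add: val_def wt_append algebra_simps)
    next
      case True
      then obtain as bs where split: "p = as @ y # bs" by (meson split_list)
      \<comment> \<open>The new arc closes a cycle; removing the cycle from the walk does not lower its value.\<close>
      have cyc: "dcycle A (y # bs)"
        using p xy by (auto simp: split dcycle_def dpath_def dest: walk_appendD2)
      then have "length (y # bs) \<le> K" by (rule short)
      moreover have "1 \<le> wt w (y # bs) + w (x, y)"
        using w cyc p(2) unfolding positive_weighting_def dcycle_def dpath_def split by force
      then have "K * 1 \<le> K * (wt w (y # bs) + w (x, y))"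
        by (intro mult_le_mono2)
      ultimately have "length (y # bs) \<le> K * (wt w (y # bs) + w (x, y))"
        by linarith
      then have neg: "int (length (y # bs)) \<le> int K * (int (wt w (y # bs)) + int (w (x, y)))"
        by (metis of_nat_le_iff of_nat_mult of_nat_add)
      have pre: "dpath A (as @ [y])"
        using p by (cases "as = []") (auto simp: dpath_def split walk_append)
      have "wt w p = wt w (as @ [y]) + wt w (y # bs)"
        by (cases "as = []") (auto simp: split wt_append)
      then have "val p + 1 - int K * int (w (x, y)) \<le> val (as @ [y])"
        using neg by (simp add: val_def split algebra_simps)
      also have "\<dots> \<le> c y" using c_ge[OF pre] by simp
      finally show ?thesis using p by simp
    qed
  qed
  have steps: "c (hd p) + int (length p) - 1 - int K * int (wt w p) \<le> c (last p)" if "walk A p" for p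
    using that
  proof (induction p rule: induct_list012)
    case (3 a b p)
    then show ?case using step[of a b] by (auto simp: walk_Cons algebra_simps)
  qed auto
  have diff: "1 \<le> \<bar>c x - c y\<bar> \<and> \<bar>c x - c y\<bar> < int K" if xy: "(x, y) \<in> A" for x y
  proof -
    obtain p where p: "walk A p" "hd p = y" "last p = x" "wt w p + w (x, y) = 1"
      using coh[OF xy] by blast
    have "2 \<le> length p"
      using p xy irrefl by (cases p; cases "tl p") auto
    then show ?thesis using steps[OF p(1)] step[OF xy] p(2,3,4)
      by (cases "w (x, y)") auto
  qed
  show ?thesis
  proof (rule that[of "\<lambda>v. nat (c v mod int K)"])
    show "nat (c v mod int K) < K" for v
      using K by (simp add: nat_less_iff)
    show "nat (c x mod int K) \<noteq> nat (c y mod int K)" if "(x, y) \<in> A" for x y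
    proof
      assume "nat (c x mod int K) = nat (c y mod int K)"
      then have "c x mod int K = c y mod int K" using K by (simp add: nat_eq_iff)
      then have "int K dvd c x - c y" by (simp add: mod_eq_dvd_iff)
      then have "int K \<le> \<bar>c x - c y\<bar>" using diff[OF that]
        by (metis abs_0_eq dvd_abs_iff not_one_le_zero zdvd_imp_le zero_less_abs_iff)
      with diff[OF that] show False by simp
    qed
  qed
qed

lemma walk_concat:
  assumes "ps \<noteq> []" "\<And>p. p \<in> set ps \<Longrightarrow> walk E p"
    "\<And>i. Suc i < length ps \<Longrightarrow> (last (ps ! i), hd (ps ! Suc i)) \<in> E"
  shows "walk E (concat ps) \<and> hd (concat ps) = hd (hd ps) \<and> last (concat ps) = last (last ps)"
  using assms
proof (induction ps)
  case (Cons p ps)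
  show ?case
  proof (cases "ps = []")
    case False
    have p: "walk E p" "p \<noteq> []" using Cons.prems(2)[of p] by (auto simp: walk_def)
    have IH: "walk E (concat ps) \<and> hd (concat ps) = hd (hd ps) \<and> last (concat ps) = last (last ps)"
      using False Cons.prems(2) Cons.prems(3)[of "Suc _"] by (intro Cons.IH) auto
    then have "concat ps \<noteq> []" by (auto simp del: concat_eq_Nil_conv)
    moreover have "(last p, hd (hd ps)) \<in> E"
      using Cons.prems(3)[of 0] False by (simp add: hd_conv_nth)
    ultimately show ?thesis
      using False p IH by (simp add: walk_append del: concat_eq_Nil_conv)
  qed (use Cons.prems(2)[of p] in simp)
qed simp

lemma dcycle_rotate: "dcycle E (as @ bs) \<Longrightarrow> dcycle E (bs @ as)"
  by (cases "as = []"; cases "bs = []") (auto simp: dcycle_def dpath_def walk_append)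

text \<open>
  Here \<open>p\<close> is a stretch of the cycle, and the other way round leads from its end to its start.
\<close>

lemma dcycle_complement:
  assumes "dcycle E (p @ q)" "2 \<le> length p"
  shows "dpath E (last p # q @ [hd p])" "hd p \<noteq> last p"
proof -
  obtain s m t where p: "p = s # m @ [t]"
    using assms(2) by (cases p; cases "tl p" rule: rev_cases) auto
  have "dcycle E ((t # q) @ (s # m))"
    using dcycle_rotate[of E "s # m" "t # q"] assms(1) by (simp add: p)
  then have "dpath E ((t # q @ [s]) @ m)" by (simp add: dcycle_def)
  then show "dpath E (last p # q @ [hd p])"
    unfolding dpath_def using walk_appendD1[of E "t # q @ [s]" m] by (auto simp: p)
  show "hd p \<noteq> last p" using assms(1) by (simp add: p dcycle_def dpath_def)
qed

section \<open>The cyclic arcs of a vertex list\<close>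

definition cycle_arcs :: "'v list \<Rightarrow> ('v \<times> 'v) set" where
  "cycle_arcs Z = {(Z ! i, Z ! (Suc i mod length Z)) | i. i < length Z}"

lemma cycle_arcs_subset: "cycle_arcs Z \<subseteq> set Z \<times> set Z"
proof -
  have "Suc i mod length Z < length Z" if "i < length Z" for i
    using that by (intro mod_less_divisor) linarith
  then show ?thesis by (auto simp: cycle_arcs_def)
qed

lemma cycle_arcs_rotate: "cycle_arcs (bs @ as) = cycle_arcs (as @ bs)"
proof -
  have sub: "cycle_arcs (rotate m Z) \<subseteq> cycle_arcs Z" for m and Z :: "'v list"
  proof -
    have "\<exists>j < length Z. rotate m Z ! i = Z ! j \<and> rotate m Z ! (Suc i mod length Z) = Z ! (Suc j mod length Z)"
      if i: "i < length Z" for i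
    proof (intro exI conjI)
      show "(m + i) mod length Z < length Z" using i by (intro mod_less_divisor) linarith
      show "rotate m Z ! i = Z ! ((m + i) mod length Z)" using i by (simp add: nth_rotate)
      have "Suc i mod length Z < length Z" using i by (intro mod_less_divisor) linarith
      then show "rotate m Z ! (Suc i mod length Z) = Z ! (Suc ((m + i) mod length Z) mod length Z)"
        by (simp add: nth_rotate mod_simps)
    qed
    then show ?thesis unfolding cycle_arcs_def by fastforce
  qed
  have "cycle_arcs (bs @ as) \<subseteq> cycle_arcs (as @ bs)" for as bs :: "'v list"
    using sub[of "length as" "as @ bs"] by (simp add: rotate_append)
  then show ?thesis by blast
qed

lemma dcycle_iff_cycle_arcs: "dcycle E Z \<longleftrightarrow> Z \<noteq> [] \<and> distinct Z \<and> cycle_arcs Z \<subseteq> E"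
proof -
  have "walk E Z \<and> (last Z, hd Z) \<in> E \<longleftrightarrow> cycle_arcs Z \<subseteq> E" if ne: "Z \<noteq> []"
  proof -
    have "cycle_arcs Z = insert (last Z, hd Z) {(Z ! i, Z ! Suc i) | i. Suc i < length Z}" (is "_ = ?R")
    proof (intro set_eqI iffI)
      fix e assume "e \<in> cycle_arcs Z"
      then obtain i where i: "i < length Z" "e = (Z ! i, Z ! (Suc i mod length Z))"
        by (auto simp: cycle_arcs_def)
      show "e \<in> ?R"
      proof (cases "Suc i = length Z")
        case True
        then have "length Z - 1 = i" by simp
        then show ?thesis using ne True i by (simp add: last_conv_nth hd_conv_nth)
      qed (use i in auto)
    next
      fix e assume "e \<in> ?R"
      then consider "e = (last Z, hd Z)" | i where "Suc i < length Z" "e = (Z ! i, Z ! Suc i)" by blast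
      then show "e \<in> cycle_arcs Z"
      proof cases
        case 1
        then show ?thesis using ne unfolding cycle_arcs_def
          by (intro CollectI exI[of _ "length Z - 1"]) (auto simp: last_conv_nth hd_conv_nth)
      next
        case 2
        then show ?thesis unfolding cycle_arcs_def
          by (intro CollectI exI[of _ i]) auto
      qed
    qed
    then show ?thesis using ne by (auto simp: walk_nth)
  qed
  then show ?thesis by (auto simp: dcycle_def dpath_def)
qed

lemma cycle_arcs_connect:
  assumes "distinct Z" "a \<in> set Z" "b \<in> set Z"
  shows "(a, b) \<in> (cycle_arcs Z)\<^sup>*"
proof -
  obtain as bs where Z: "Z = as @ a # bs" using assms(2) by (meson split_list)
  have "dcycle (cycle_arcs Z) ((a # bs) @ as)"
    using assms(1) cycle_arcs_rotate[of as "a # bs"] by (auto simp: dcycle_iff_cycle_arcs Z)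
  then show ?thesis
    using walk_imp_rtrancl[of "cycle_arcs Z" "(a # bs) @ as" b] assms(3)
    by (auto simp: dcycle_def dpath_def Z)
qed

text \<open>
  Since an arc of the cycle determines the next one, a path along the cycle is a stretch of it,
  and after a rotation it is an initial segment.
\<close>

lemma path_in_cycle_arcs:
  assumes Z: "distinct Z" and p: "dpath (cycle_arcs Z) p" and long: "2 \<le> length p"
  obtains as bs rest where "Z = as @ bs" "bs @ as = p @ rest"
proof -
  have sub: "set p \<subseteq> set Z"
  proof
    fix x assume "x \<in> set p"
    then obtain i where i: "i < length p" "x = p ! i" by (auto simp: in_set_conv_nth)
    have arcs: "(p ! j, p ! Suc j) \<in> set Z \<times> set Z" if "Suc j < length p" for j
      using p that cycle_arcs_subset by (fastforce simp: dpath_def walk_nth)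
    show "x \<in> set Z"
    proof (cases i)
      case 0
      then show ?thesis using arcs[of 0] i long by simp
    next
      case (Suc j)
      then show ?thesis using arcs[of j] i by simp
    qed
  qed
  then have "hd p \<in> set Z" using long by (cases p) auto
  then obtain as bs' where split: "Z = as @ hd p # bs'" by (meson split_list)
  define Y where "Y = (hd p # bs') @ as"
  have Y: "distinct Y" "set Y = set Z" "cycle_arcs Y = cycle_arcs Z"
    using Z cycle_arcs_rotate[of as "hd p # bs'"] by (auto simp: Y_def split)
  have len: "length p \<le> length Y"
    using sub p Y(1,2) by (metis card_mono distinct_card dpath_def finite_set)
  have nth: "p ! i = Y ! i" if "i < length p" for i
    using that
  proof (induction i)
    case 0
    then show ?case by (simp add: Y_def hd_conv_nth)
  next
    case (Suc i)
    then have "(p ! i, p ! Suc i) \<in> cycle_arcs Y" "p ! i = Y ! i"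
      using p Y(3) by (auto simp: dpath_def walk_nth)
    then obtain j where j: "j < length Y" "Y ! i = Y ! j" "p ! Suc i = Y ! (Suc j mod length Y)"
      by (auto simp: cycle_arcs_def)
    then have "i = j" using Y(1) Suc.prems len by (simp add: nth_eq_iff_index_eq)
    then show ?case using j Suc.prems len by simp
  qed
  have "p = take (length p) Y" using len nth by (intro nth_equalityI) auto
  then have "Y = p @ drop (length p) Y" by (metis append_take_drop_id)
  then show ?thesis using that[of as "hd p # bs'"] split by (auto simp: Y_def)
qed

section \<open>Growing long cycles greedily\<close>

text \<open>
  The length of a list counts vertices, hence the strict inequalities.
\<close>

definition spindle_free :: "('v \<times> 'v) set \<Rightarrow> nat \<Rightarrow> nat \<Rightarrow> bool" where
  "spindle_free E k l \<longleftrightarrow>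
     \<not> (\<exists>p q. dpath E p \<and> dpath E q \<and> hd p = hd q \<and> last p = last q \<and> hd p \<noteq> last p \<and>
          set p \<inter> set q \<subseteq> {hd p, last p} \<and> k < length p \<and> l < length q)"

lemma spindle_freeD:
  "spindle_free E k l \<Longrightarrow> dpath E p \<Longrightarrow> dpath E q \<Longrightarrow> hd p = u \<Longrightarrow> hd q = u \<Longrightarrow>
    last p = v \<Longrightarrow> last q = v \<Longrightarrow> u \<noteq> v \<Longrightarrow> set p \<inter> set q \<subseteq> {u, v} \<Longrightarrow>
    k < length p \<Longrightarrow> l < length q \<Longrightarrow> False"
  unfolding spindle_free_def by metis

text \<open>
  The vertices of \<open>Z\<close> lie in pairwise different components of \<open>K\<close>. All relations \<open>K\<close> of interest
  are unions of cycles, so their components are classes of \<open>K\<^sup>*\<close>.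
\<close>

definition independent :: "('v \<times> 'v) set \<Rightarrow> 'v list \<Rightarrow> bool" where
  "independent K Z \<longleftrightarrow> (\<forall>a \<in> set Z. \<forall>b \<in> set Z. (a, b) \<in> K\<^sup>* \<longrightarrow> a = b)"

text \<open>
  The proof of \<open>greedy_rigid\<close> uses that \<open>Z\<close> is longest: a cycle that is considered later but was
  independent already when \<open>Z\<close> was chosen is not longer than \<open>Z\<close>.
\<close>

inductive greedy :: "('v \<times> 'v) set \<Rightarrow> nat \<Rightarrow> ('v \<times> 'v) set \<Rightarrow> bool" for E L where
  greedy_empty: "greedy E L {}"
| greedy_step: "greedy E L K \<Longrightarrow> dcycle E Z \<Longrightarrow> L \<le> length Z \<Longrightarrow> independent K Z \<Longrightarrow>
    (\<And>W. dcycle E W \<Longrightarrow> independent K W \<Longrightarrow> length W \<le> length Z) \<Longrightarrow>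
    greedy E L (K \<union> cycle_arcs Z)"

lemma greedy_subset: "greedy E L K \<Longrightarrow> K \<subseteq> E"
  by (induction rule: greedy.induct) (auto simp: dcycle_iff_cycle_arcs)

lemma greedy_sym:
  assumes "greedy E L K"
  shows "sym (K\<^sup>*)"
  using assms
proof (induction rule: greedy.induct)
  case (greedy_step K Z)
  let ?K' = "K \<union> cycle_arcs Z"
  have "(b, a) \<in> ?K'\<^sup>*" if "(a, b) \<in> ?K'" for a b
  proof (cases "(a, b) \<in> K")
    case True
    then have "(b, a) \<in> K\<^sup>*" using greedy_step.IH by (auto dest: symD)
    then show ?thesis by (rule rtrancl_mono[THEN subsetD, rotated]) blast
  next
    case False
    then have "(b, a) \<in> (cycle_arcs Z)\<^sup>*"
      using that cycle_arcs_subset[of Z] greedy_step.hyps(2)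
      by (intro cycle_arcs_connect) (auto simp: dcycle_def dpath_def)
    then show ?thesis by (rule rtrancl_mono[THEN subsetD, rotated]) blast
  qed
  then have "?K'\<inverse> \<subseteq> ?K'\<^sup>*" by auto
  then have "(?K'\<inverse>)\<^sup>* \<subseteq> ?K'\<^sup>*" by (rule rtrancl_subset_rtrancl)
  then show ?case by (auto simp: rtrancl_converse intro!: symI)
qed (simp add: sym_Id)

lemma maximal_greedy:
  assumes fin: "finite E" and L: "2 \<le> L"
  obtains K where "greedy E L K" "\<And>W. dcycle E W \<Longrightarrow> independent K W \<Longrightarrow> length W < L"
proof -
  have "\<forall>K. greedy E L K \<longrightarrow> card K < Suc (card E)"
    using card_mono[OF fin greedy_subset] by (simp add: less_Suc_eq_le)
  from ex_has_greatest_nat[of "greedy E L", OF greedy_empty this]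
  obtain K where K: "greedy E L K" and max: "\<And>K'. greedy E L K' \<Longrightarrow> card K' \<le> card K"
    by blast
  have "length W < L" if W: "dcycle E W" "independent K W" for W
  proof (rule ccontr)
    assume "\<not> length W < L"
    define Q where "Q Z \<longleftrightarrow> dcycle E Z \<and> independent K Z" for Z
    have bound: "length Z \<le> card (Field E)" if "dcycle E Z" for Z
    proof -
      have "set Z \<subseteq> Field E"
      proof
        fix x assume "x \<in> set Z"
        then obtain i where "i < length Z" "x = Z ! i" by (auto simp: in_set_conv_nth)
        then have "(x, Z ! (Suc i mod length Z)) \<in> cycle_arcs Z" by (auto simp: cycle_arcs_def)
        then show "x \<in> Field E" using that by (auto simp: dcycle_iff_cycle_arcs Field_def)
      qed
      then have "card (set Z) \<le> card (Field E)" using fin by (intro card_mono finite_Field)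
      moreover have "card (set Z) = length Z"
        using that by (intro distinct_card) (simp add: dcycle_iff_cycle_arcs)
      ultimately show ?thesis by simp
    qed
    have "Q W" using W by (simp add: Q_def)
    moreover have "\<forall>Z. Q Z \<longrightarrow> length Z < Suc (card (Field E))"
      using bound by (simp add: Q_def less_Suc_eq_le)
    ultimately obtain Z where Z: "Q Z" "\<And>Z'. Q Z' \<Longrightarrow> length Z' \<le> length Z"
      using ex_has_greatest_nat[of Q W length] by blast
    have LZ: "L \<le> length Z" using Z(2)[of W] W \<open>\<not> length W < L\<close> by (simp add: Q_def)
    have "greedy E L (K \<union> cycle_arcs Z)"
      using K LZ Z by (intro greedy_step) (auto simp: Q_def)
    moreover have "K \<subset> K \<union> cycle_arcs Z"
    proof -
      have dist: "distinct Z" using Z(1) by (auto simp: Q_def dcycle_iff_cycle_arcs)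
      have "(Z ! 0, Z ! 1) \<in> cycle_arcs Z"
        using LZ L unfolding cycle_arcs_def by (intro CollectI exI[of _ 0]) auto
      moreover have "(Z ! 0, Z ! 1) \<notin> K"
      proof
        assume "(Z ! 0, Z ! 1) \<in> K"
        moreover have "Z ! 0 \<in> set Z" "Z ! 1 \<in> set Z" using LZ L by (auto intro!: nth_mem)
        ultimately have "Z ! 0 = Z ! 1"
          using Z(1) unfolding Q_def independent_def by blast
        moreover have "0 < length Z" "1 < length Z" using LZ L by linarith+
        ultimately show False using nth_eq_iff_index_eq[OF dist] by auto
      qed
      ultimately show ?thesis by blast
    qed
    moreover have "finite (K \<union> cycle_arcs Z)"
      using finite_subset[OF greedy_subset fin] calculation(1) .
    ultimately have "card K < card (K \<union> cycle_arcs Z)" by (intro psubset_card_mono)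
    with max[OF \<open>greedy E L (K \<union> cycle_arcs Z)\<close>] show False by simp
  qed
  with K show ?thesis using that by blast
qed

text \<open>
  Cycles of \<open>E\<close> that pass through components of \<open>K\<close> are cut into pieces that run along \<open>K\<close>; the
  pieces belong to pairwise different components.
\<close>

definition separated :: "('v \<times> 'v) set \<Rightarrow> 'v list list \<Rightarrow> bool" where
  "separated K ps \<longleftrightarrow> sorted_wrt (\<lambda>p q. \<forall>a \<in> set p. \<forall>b \<in> set q. (a, b) \<notin> K\<^sup>*) ps"

text \<open>
  The cycle \<open>Z\<close> meets the component of \<open>a\<close> only in \<open>a\<close>, so a path that has left this component
  through \<open>a\<close> cannot come back.
\<close>

lemma stays_away:
  assumes "sym (K\<^sup>*)" "walk (K \<union> cycle_arcs Z) p" "independent K Z" "a \<in> set Z" "a \<notin> set p" "(a, hd p) \<notin> K\<^sup>*"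
    "b \<in> set p"
  shows "(a, b) \<notin> K\<^sup>*"
  using assms
proof (induction p)
  case (Cons x p)
  show ?case
  proof (cases "p = [] \<or> b = x")
    case False
    have "(a, hd p) \<notin> K\<^sup>*"
    proof (cases "(x, hd p) \<in> K")
      case True
      then have "(hd p, x) \<in> K\<^sup>*" using Cons.prems(1) by (auto dest: symD)
      then show ?thesis using Cons.prems by (auto intro: rtrancl_trans)
    next
      case False
      then have "hd p \<in> set Z" using Cons.prems \<open>\<not> (p = [] \<or> b = x)\<close> cycle_arcs_subset[of Z]
        by (auto simp: walk_Cons)
      moreover have "hd p \<noteq> a"
        using Cons.prems(5) \<open>\<not> (p = [] \<or> b = x)\<close> by (metis hd_in_set list.set_intros(2))
      ultimately show ?thesis
        using Cons.prems(3,4) unfolding independent_def by metis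
    qed
    then show ?thesis
      using Cons False by (auto simp: walk_Cons)
  qed (use Cons in auto)
qed simp


text \<open>
  The path is cut at the arcs of \<open>Z\<close>. By \<open>stays_away\<close>, it visits no component of \<open>K\<close> twice.
\<close>

lemma split_at_cycle:
  assumes "sym (K\<^sup>*)" "independent K Z" "walk (K \<union> cycle_arcs Z) p" "distinct p"
  shows "\<exists>qs. concat qs = p \<and> (\<forall>q \<in> set qs. walk K q) \<and> separated K qs"
  using assms
proof (induction p)
  case (Cons x p)
  show ?case
  proof (cases "p = []")
    case True
    then show ?thesis by (intro exI[of _ "[[x]]"]) (simp add: separated_def)
  next
    case False
    with Cons obtain qs where qs: "concat qs = p" "\<forall>q \<in> set qs. walk K q" "separated K qs"
      by (auto simp: walk_Cons)
    with False obtain q qs' where q: "qs = q # qs'" "q \<noteq> []" by (cases qs) auto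
    have hd: "hd p = hd q" using qs(1) q by auto
    show ?thesis
    proof (cases "(x, hd p) \<in> K")
      case True
      have "(x, b) \<notin> K\<^sup>*" if "q' \<in> set qs'" "b \<in> set q'" for q' b
      proof
        assume "(x, b) \<in> K\<^sup>*"
        moreover have "(hd q, x) \<in> K\<^sup>*" using True hd Cons.prems(1) by (auto dest: symD)
        ultimately have "(hd q, b) \<in> K\<^sup>*" by (rule rtrancl_trans[rotated])
        then show False using qs(3) q that by (auto simp: separated_def)
      qed
      then have "separated K ((x # q) # qs')"
        using qs(3) q by (auto simp: separated_def)
      then show ?thesis
        using qs q True hd by (intro exI[of _ "(x # q) # qs'"]) (auto simp: walk_Cons)
    next
      case nK: False
      then have arc: "(x, hd p) \<in> cycle_arcs Z" using Cons.prems(3) False by (auto simp: walk_Cons)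
      then have xZ: "x \<in> set Z" "hd p \<in> set Z" using cycle_arcs_subset[of Z] by auto
      have "(x, hd p) \<notin> K\<^sup>*"
        using Cons.prems(2,4) False xZ unfolding independent_def
        by (metis distinct.simps(2) hd_in_set)
      then have "(x, b) \<notin> K\<^sup>*" if "b \<in> set p" for b
        using stays_away[OF Cons.prems(1) _ Cons.prems(2) xZ(1), of p b] Cons.prems False that
        by (auto simp: walk_Cons)
      then have "separated K ([x] # qs)"
        using qs(3) unfolding qs(1)[symmetric] separated_def by auto
      then show ?thesis
        using qs by (intro exI[of _ "[x] # qs"]) auto
    qed
  qed
qed (auto intro!: exI[of _ "[]"] simp: separated_def)

lemma separated_refine:
  assumes "\<forall>p \<in> set ps. \<exists>qs. concat qs = p \<and> (\<forall>q \<in> set qs. walk K q) \<and> separated K qs"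
    "separated K ps" "[] \<notin> set ps"
  shows "\<exists>qs. concat qs = concat ps \<and> (\<forall>q \<in> set qs. walk K q) \<and> separated K qs \<and> length ps \<le> length qs"
  using assms
proof (induction ps)
  case (Cons p ps)
  then obtain qs where qs: "concat qs = concat ps" "\<forall>q \<in> set qs. walk K q" "separated K qs"
    "length ps \<le> length qs"
    by (auto simp: separated_def)
  obtain rs where rs: "concat rs = p" "\<forall>q \<in> set rs. walk K q" "separated K rs"
    using Cons.prems(1) by auto
  have "rs \<noteq> []" using rs(1) Cons.prems(3) by auto
  then have "1 \<le> length rs" by (cases rs) auto
  moreover have "separated K (rs @ qs)"
    unfolding separated_def sorted_wrt_append
  proof (intro conjI ballI)
    show "sorted_wrt (\<lambda>p q. \<forall>a\<in>set p. \<forall>b\<in>set q. (a, b) \<notin> K\<^sup>*) rs"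
      "sorted_wrt (\<lambda>p q. \<forall>a\<in>set p. \<forall>b\<in>set q. (a, b) \<notin> K\<^sup>*) qs"
      using rs(3) qs(3) by (simp_all add: separated_def)
    fix r q a b assume "r \<in> set rs" "q \<in> set qs" "a \<in> set r" "b \<in> set q"
    then have "a \<in> set (concat rs)" "b \<in> set (concat qs)" by auto
    then have "a \<in> set p" "\<exists>p' \<in> set ps. b \<in> set p'" by (simp_all add: rs(1) qs(1))
    then show "(a, b) \<notin> K\<^sup>*" using Cons.prems(2) by (auto simp: separated_def)
  qed
  ultimately show ?case
    using qs rs by (intro exI[of _ "rs @ qs"]) auto
qed (auto intro!: exI[of _ "[]"] simp: separated_def)

lemma separated_mono: "separated K ps \<Longrightarrow> K' \<subseteq> K \<Longrightarrow> separated K' ps"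
  unfolding separated_def by (erule sorted_wrt_mono_rel[rotated]) (use rtrancl_mono in blast)

lemma independent_if_singletons:
  assumes "sym (K\<^sup>*)" "separated K ps" "\<forall>p \<in> set ps. length p = 1"
  shows "independent K (concat ps)"
proof -
  have "a = b" if pq: "p \<in> set ps" "q \<in> set ps" and "a \<in> set p" "b \<in> set q" "(a, b) \<in> K\<^sup>*" for a b p q
  proof -
    obtain i j where ij: "i < length ps" "j < length ps" "p = ps ! i" "q = ps ! j"
      using pq by (metis in_set_conv_nth)
    have "\<not> i < j" "\<not> j < i"
      using assms(1,2) that ij by (auto simp: separated_def sorted_wrt_iff_nth_less dest: symD)
    then have "p = q" using ij by (metis nat_neq_iff)
    moreover obtain x where "p = [x]" using assms(3) pq(1) by (auto simp: length_Suc_conv)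
    ultimately show ?thesis using that by auto
  qed
  then show ?thesis by (auto simp: independent_def)
qed

text \<open>
  The induction undoes the choices one by one. A cycle \<open>W\<close> that consists of pieces along
  \<open>K \<union> cycle_arcs Z\<close> also consists of pieces along \<open>K\<close>, so by induction hypothesis it is independent
  of \<open>K\<close> and was a candidate when \<open>Z\<close> was chosen; thus \<open>W\<close> is not longer than \<open>Z\<close>. If a
  piece \<open>p\<close> of \<open>W\<close> has an arc, then \<open>p\<close> is a stretch of \<open>Z\<close>. The rest \<open>out\<close> of \<open>W\<close> contains
  all other pieces and is not longer than the rest of \<open>Z\<close>, so both
  rests have at least \<open>k\<close> arcs. They lead from the end of \<open>p\<close> to its start and are
  disjoint, because the other pieces lie in other components than \<open>Z\<close>.
\<close>

lemma greedy_rigid: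
  assumes greedy: "greedy E L K" and free: "spindle_free E k l" and kL: "k \<le> L" "l \<le> k"
    and irrefl: "\<And>x. (x, x) \<notin> E"
    and "dcycle E (concat ps)" "\<forall>p \<in> set ps. walk K p" "separated K ps" "L \<le> length ps"
  shows "independent K (concat ps)"
  using greedy assms(6-)
proof (induction arbitrary: ps rule: greedy.induct)
  case greedy_empty
  then show ?case by (auto simp: independent_def)
next
  case (greedy_step K Z ps)
  let ?K' = "K \<union> cycle_arcs Z"
  have sym: "sym (K\<^sup>*)" "sym (?K'\<^sup>*)"
    using greedy_sym greedy.greedy_step[OF greedy_step.hyps] greedy_step.hyps(1) by blast+
  have KE: "K \<subseteq> E" using greedy_subset greedy_step.hyps(1) .
  have W: "distinct (concat ps)" "[] \<notin> set ps" using greedy_step.prems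
    by (auto simp: dcycle_def dpath_def walk_def)
  then have dist: "distinct p" if "p \<in> set ps" for p using that by (auto simp: distinct_concat_iff)
  have pieces: "\<forall>p \<in> set ps. \<exists>qs. concat qs = p \<and> (\<forall>q \<in> set qs. walk K q) \<and> separated K qs"
    using split_at_cycle[OF sym(1) greedy_step.hyps(4)] greedy_step.prems(2) dist by blast
  have "separated K ps" using greedy_step.prems(3) by (rule separated_mono) blast
  from separated_refine[OF pieces this W(2)]
  obtain qs where qs: "concat qs = concat ps" "\<forall>q \<in> set qs. walk K q" "separated K qs"
    "length ps \<le> length qs" by blast
  have ind: "independent K (concat ps)"
    using greedy_step.IH[of qs] qs greedy_step.prems(1,4) by auto
  then have short: "length (concat ps) \<le> length Z"
    using greedy_step.hyps(5) greedy_step.prems(1) by blast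
  have "length p = 1" if p: "p \<in> set ps" for p
  proof (rule ccontr)
    assume "length p \<noteq> 1"
    moreover have "p \<noteq> []" using p W(2) by auto
    ultimately have len: "2 \<le> length p" by (cases p; cases "tl p") auto
    have "(a, b) \<in> cycle_arcs Z" if "a \<in> set p" "b \<in> set p" "(a, b) \<in> ?K'" for a b
    proof (rule ccontr)
      assume "(a, b) \<notin> cycle_arcs Z"
      then have ab: "(a, b) \<in> K" using that by blast
      then have "a = b"
        using ind that(1,2) p r_into_rtrancl[OF ab] unfolding independent_def by auto
      then show False using ab KE irrefl by auto
    qed
    moreover have "walk ?K' p" using greedy_step.prems(2) p by blast
    ultimately have "dpath (cycle_arcs Z) p"
      using dist[OF p] unfolding dpath_def walk_def
      by (auto elim!: successively_mono)
    moreover have Z: "dcycle E Z" "distinct Z"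
      using greedy_step.hyps(2) by (auto simp: dcycle_def dpath_def)
    ultimately obtain as bs rest where Zs: "Z = as @ bs" "bs @ as = p @ rest"
      using path_in_cycle_arcs len by metis
    have Zrest: "dcycle E (p @ rest)" using dcycle_rotate[of E as bs] Z Zs by simp
    obtain ps1 ps2 where ps: "ps = ps1 @ p # ps2" using p by (meson split_list)
    define out where "out = concat ps2 @ concat ps1"
    have Wout: "dcycle E (p @ out)"
      using dcycle_rotate[of E "concat ps1" "p @ concat ps2"] greedy_step.prems(1)
      by (simp add: ps out_def)
    have "length qs \<le> length (concat qs)" if "[] \<notin> set qs" for qs :: "'a list list"
      using that
    proof (induction qs)
      case (Cons q qs)
      then show ?case by (cases q) auto
    qed simp
    from this[of "ps2 @ ps1"] have "length ps - 1 \<le> length out"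
      using W(2) by (auto simp: out_def ps)
    then have out: "k \<le> Suc (length out)" using greedy_step.prems(4) kL(1) by linarith
    have "length Z = length p + length rest"
      using arg_cong[OF Zs(2), of length] by (simp add: Zs(1))
    moreover have "length (concat ps) = length p + length out" by (simp add: ps out_def)
    ultimately have "length out \<le> length rest" using short by linarith
    have disj: "set out \<inter> set rest = {}"
    proof (rule ccontr)
      assume "set out \<inter> set rest \<noteq> {}"
      then obtain x where x: "x \<in> set out" "x \<in> set rest" by blast
      have hdp: "hd p \<in> set p" using len by (cases p) auto
      have "set Z = set (bs @ as)" by (auto simp: Zs(1))
      also have "\<dots> = set p \<union> set rest" by (simp only: Zs(2) set_append)
      finally have "x \<in> set Z" "hd p \<in> set Z" using x hdp by auto
      then have conn: "(hd p, x) \<in> ?K'\<^sup>*" "(x, hd p) \<in> ?K'\<^sup>*"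
        using cycle_arcs_connect[OF Z(2)] rtrancl_mono[of "cycle_arcs Z" ?K'] by blast+
      obtain q where "x \<in> set q" "q \<in> set ps1 \<or> q \<in> set ps2"
        using x(1) by (auto simp: out_def)
      then show False
        using conn greedy_step.prems(3) hdp by (fastforce simp: ps separated_def sorted_wrt_append)
    qed
    show False
    proof (rule spindle_freeD[OF free dcycle_complement(1)[OF Wout len] dcycle_complement(1)[OF Zrest len]])
      show "last p \<noteq> hd p" using dcycle_complement(2)[OF Wout len] by simp
      show "set (last p # out @ [hd p]) \<inter> set (last p # rest @ [hd p]) \<subseteq> {last p, hd p}"
        using disj by auto
      show "k < length (last p # out @ [hd p])" "l < length (last p # rest @ [hd p])"
        using out kL \<open>length out \<le> length rest\<close> by auto
    qed auto
  qed
  then show ?case using independent_if_singletons[OF sym(2) greedy_step.prems(3)] by blast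
qed

text \<open>
  A cycle on the components lifts to a cycle of \<open>E\<close>: in each component, a path along \<open>K\<close> joins the
  vertex where the cycle enters to the vertex where it leaves. By \<open>greedy_rigid\<close> the lift
  is independent of \<open>K\<close>, so by maximality it is short.
\<close>

lemma quotient_has_no_long_cycle:
  assumes greedy: "greedy E L K" and free: "spindle_free E k l" and kL: "k \<le> L" "l \<le> k"
    and irrefl: "\<And>x. (x, x) \<notin> E"
    and maximal: "\<And>W. dcycle E W \<Longrightarrow> independent K W \<Longrightarrow> length W < L"
    and Xs: "dcycle {(K\<^sup>* `` {x}, K\<^sup>* `` {y}) | x y. (x, y) \<in> E \<and> (x, y) \<notin> K\<^sup>*} Xs"
  shows "length Xs < L"
proof (rule ccontr)
  assume long: "\<not> length Xs < L"
  define n where "n = length Xs"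
  have sym: "sym (K\<^sup>*)" using greedy greedy_sym by blast
  have KE: "K \<subseteq> E" using greedy greedy_subset by blast
  have Xs': "Xs \<noteq> []" "distinct Xs" using Xs by (auto simp: dcycle_iff_cycle_arcs)
  then have n: "0 < n" by (simp add: n_def)
  have "\<exists>x y. (x, y) \<in> E \<and> Xs ! i = K\<^sup>* `` {x} \<and> Xs ! (Suc i mod n) = K\<^sup>* `` {y}" if "i < n" for i
  proof -
    have "(Xs ! i, Xs ! (Suc i mod n)) \<in> cycle_arcs Xs" using that by (auto simp: cycle_arcs_def n_def)
    then show ?thesis using Xs unfolding dcycle_iff_cycle_arcs by blast
  qed
  then obtain x y where xy: "\<And>i. i < n \<Longrightarrow> (x i, y i) \<in> E" "\<And>i. i < n \<Longrightarrow> Xs ! i = K\<^sup>* `` {x i}"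
    "\<And>i. i < n \<Longrightarrow> Xs ! (Suc i mod n) = K\<^sup>* `` {y i}"
    by metis
  \<comment> \<open>The cycle leaves the \<open>i\<close>-th component at \<open>x i\<close> and enters it at \<open>y (prev i)\<close>.\<close>
  define prev where "prev i = (i + (n - 1)) mod n" for i
  have prev: "prev i < n" "Suc (prev i) mod n = i" if "i < n" for i
    using that n by (simp_all add: prev_def mod_Suc_eq)
  have "\<exists>p. dpath K p \<and> hd p = y (prev i) \<and> last p = x i" if i: "i < n" for i
  proof -
    have "K\<^sup>* `` {x i} = K\<^sup>* `` {y (prev i)}" using xy(2)[OF i] xy(3)[OF prev(1)[OF i]] prev(2)[OF i] by simp
    then have "(y (prev i), x i) \<in> K\<^sup>*" by blast
    then show ?thesis using rtrancl_imp_dpath by metis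
  qed
  then obtain P where P: "\<And>i. i < n \<Longrightarrow> dpath K (P i) \<and> hd (P i) = y (prev i) \<and> last (P i) = x i"
    by metis
  define ps where "ps = map P [0..<n]"
  have len: "length ps = n" by (simp add: ps_def)
  have P_class: "a \<in> Xs ! i" if "i < n" "a \<in> set (P i)" for i a
  proof -
    have "(y (prev i), a) \<in> K\<^sup>*" using P[OF that(1)] walk_imp_rtrancl that(2) by (metis dpath_def)
    then show ?thesis using xy(3)[OF prev(1)] prev(2) that(1) by auto
  qed
  have diff: "(a, b) \<notin> K\<^sup>*" if "i < n" "j < n" "i \<noteq> j" "a \<in> set (P i)" "b \<in> set (P j)" for i j a b
  proof
    assume "(a, b) \<in> K\<^sup>*"
    moreover have "(x i, a) \<in> K\<^sup>*" "(x j, b) \<in> K\<^sup>*" using P_class xy(2) that by auto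
    ultimately have "(x i, x j) \<in> K\<^sup>*" "(x j, x i) \<in> K\<^sup>*"
      using sym by (meson rtrancl_trans symD)+
    then have "Xs ! i = Xs ! j" using xy(2) that by (auto intro: rtrancl_trans)
    then show False using Xs'(2) that by (simp add: nth_eq_iff_index_eq n_def)
  qed
  have sep: "separated K ps"
    unfolding separated_def sorted_wrt_iff_nth_less ps_def
  proof (intro allI impI ballI)
    fix i j a b
    assume "i < j" "j < length (map P [0..<n])" "a \<in> set (map P [0..<n] ! i)" "b \<in> set (map P [0..<n] ! j)"
    then show "(a, b) \<notin> K\<^sup>*" using diff[of i j a b] by simp
  qed
  have walks: "\<forall>p \<in> set ps. walk K p" using P by (auto simp: ps_def dpath_def)
  have "walk E (concat ps) \<and> hd (concat ps) = hd (hd ps) \<and> last (concat ps) = last (last ps)"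
  proof (rule walk_concat)
    show "ps \<noteq> []" using n by (simp add: ps_def)
    show "walk E p" if "p \<in> set ps" for p using walks that KE walk_mono by blast
    show "(last (ps ! i), hd (ps ! Suc i)) \<in> E" if "Suc i < length ps" for i
    proof -
      have "prev (Suc i) = i" using that n by (simp add: prev_def len)
      then show ?thesis using P[of i] P[of "Suc i"] xy(1)[of i] that by (simp add: ps_def)
    qed
  qed
  moreover have "(last (last ps), hd (hd ps)) \<in> E"
  proof -
    have "last ps = P (n - 1)" "hd ps = P 0" using n by (simp_all add: ps_def last_map hd_map)
    moreover have "prev 0 = n - 1" using n by (simp add: prev_def)
    ultimately show ?thesis using P[of 0] P[of "n - 1"] xy(1)[of "n - 1"] n by simp
  qed
  moreover have "distinct (concat ps)"
  proof -
    have disj: "set (P i) \<inter> set (P j) = {}" if "i < n" "j < n" "i \<noteq> j" for i j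
      using diff[OF that] by blast
    have "P i \<noteq> []" if "i < n" for i using P[OF that] by (auto simp: dpath_def)
    then have "P i \<noteq> P j" if "i < n" "j < n" "i \<noteq> j" for i j
      using disj[OF that] that(1) by fastforce
    then have "distinct ps" unfolding ps_def distinct_map inj_on_def by fastforce
    moreover have "distinct p" if "p \<in> set ps" for p using that P by (auto simp: ps_def dpath_def)
    moreover have "set p \<inter> set q = {}" if pq: "p \<in> set ps" "q \<in> set ps" and neq: "p \<noteq> q" for p q
    proof -
      obtain i j where "i < n" "j < n" "p = P i" "q = P j" using pq by (auto simp: ps_def)
      then show ?thesis using disj neq by metis
    qed
    ultimately show ?thesis by (rule distinct_concat)
  qed
  ultimately have cyc: "dcycle E (concat ps)" by (simp add: dcycle_def dpath_def)
  have "independent K (concat ps)"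
    using greedy_rigid[OF greedy free kL irrefl cyc walks sep] long len by (simp add: n_def)
  then have "length (concat ps) < L" using maximal cyc by blast
  moreover have "length ps \<le> length (concat ps)"
  proof -
    have "length ps = (\<Sum>p\<leftarrow>ps. 1)" by (simp add: sum_list_triv)
    also have "\<dots> \<le> (\<Sum>p\<leftarrow>ps. length p)"
      using walks by (intro sum_list_mono) (auto simp: Suc_le_eq)
    finally show ?thesis by (simp add: length_concat)
  qed
  ultimately show False using long len by (simp add: n_def)
qed

section \<open>Rooted cactuses of long cycles\<close>

text \<open>
  The cycle \<open>cyc v\<close> passes through \<open>v\<close> and is listed from its vertex closest to the root, which is
  not \<open>v\<close>. The conditions are local, but they determine the tree-like shape: the tails of different
  lists \<open>cyc v\<close> are disjoint, and the first vertex of such a list has smaller depth than the others.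
  The value of \<open>cyc r\<close> is arbitrary.
\<close>

locale rooted_cactus =
  fixes E :: "('v \<times> 'v) set" and L :: nat and r :: 'v and P :: "'v set"
    and depth :: "'v \<Rightarrow> nat" and cyc :: "'v \<Rightarrow> 'v list"
  assumes root: "r \<in> P" "depth r = 0"
    and cyc: "\<And>v. v \<in> P \<Longrightarrow> v \<noteq> r \<Longrightarrow> dcycle E (cyc v)"
      "\<And>v. v \<in> P \<Longrightarrow> v \<noteq> r \<Longrightarrow> L \<le> length (cyc v)"
      "\<And>v. v \<in> P \<Longrightarrow> v \<noteq> r \<Longrightarrow> set (cyc v) \<subseteq> P"
      "\<And>v. v \<in> P \<Longrightarrow> v \<noteq> r \<Longrightarrow> v \<in> set (tl (cyc v))"
    and below: "\<And>v u. v \<in> P \<Longrightarrow> v \<noteq> r \<Longrightarrow> u \<in> set (tl (cyc v)) \<Longrightarrow>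
        u \<noteq> r \<and> cyc u = cyc v \<and> depth u = Suc (depth (hd (cyc v)))"

text \<open>
  When the cycle \<open>Z\<close> is added, it joins the components of its vertices to one component. The cactus
  of the component of the root \<open>r\<close> is kept, \<open>Z\<close> is attached to it at the vertex \<open>z0\<close> that they share,
  and each of the other components is attached to \<open>Z\<close> as a cactus rooted at its vertex on \<open>Z\<close>. The
  root in the induction hypothesis is therefore arbitrary.
\<close>

lemma greedy_rooted_cactus:
  assumes "greedy E L K"
  shows "\<exists>depth cyc. rooted_cactus E L r (K\<^sup>* `` {r}) depth cyc"
  using assms
proof (induction arbitrary: r rule: greedy.induct)
  case greedy_empty
  have "rooted_cactus E L r ({}\<^sup>* `` {r}) (\<lambda>_. 0) (\<lambda>_. [])"
    by unfold_locales auto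
  then show ?case by blast
next
  case (greedy_step K Z)
  let ?K' = "K \<union> cycle_arcs Z"
  have symK: "(b, a) \<in> K\<^sup>*" if "(a, b) \<in> K\<^sup>*" for a b
    using greedy_sym[OF greedy_step.hyps(1)] that by (auto dest: symD)
  have Z: "distinct Z" "dcycle E Z" using greedy_step.hyps(2) by (auto simp: dcycle_def dpath_def)
  have indep: "a = b" if "a \<in> set Z" "b \<in> set Z" "(a, b) \<in> K\<^sup>*" for a b
    using greedy_step.hyps(4) that by (auto simp: independent_def)
  have K'I: "(a, b) \<in> ?K'\<^sup>*" if "(a, b) \<in> K\<^sup>*" for a b
    using that rtrancl_mono[of K ?K'] by blast
  have K'Z: "(a, b) \<in> ?K'\<^sup>*" if "a \<in> set Z" "b \<in> set Z" for a b
    using cycle_arcs_connect[OF Z(1) that] rtrancl_mono[of "cycle_arcs Z" ?K'] by blast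
  have K'D: "(a, b) \<in> K\<^sup>* \<or> (\<exists>z \<in> set Z. \<exists>z' \<in> set Z. (a, z) \<in> K\<^sup>* \<and> (z', b) \<in> K\<^sup>*)"
    if "(a, b) \<in> ?K'\<^sup>*" for a b
    using that
  proof (induction rule: rtrancl_induct)
    case (step b c)
    show ?case
    proof (cases "(b, c) \<in> K")
      case True
      with step.IH show ?thesis by (meson rtrancl.rtrancl_into_rtrancl)
    next
      case False
      then have "b \<in> set Z" "c \<in> set Z" using step.hyps(2) cycle_arcs_subset[of Z] by auto
      with step.IH show ?thesis by blast
    qed
  qed simp
  show ?case
  proof (cases "\<exists>z \<in> set Z. (r, z) \<in> K\<^sup>*")
    case False
    then have "?K'\<^sup>* `` {r} = K\<^sup>* `` {r}" using K'I K'D by blast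
    with greedy_step.IH[of r] show ?thesis by simp
  next
    case True
    then obtain z0 where z0: "z0 \<in> set Z" "(r, z0) \<in> K\<^sup>*" by blast
    obtain as rest where split: "Z = as @ z0 # rest" using z0(1) by (meson split_list)
    define Z0 where "Z0 = z0 # rest @ as"
    have Z0: "dcycle E Z0" "set Z0 = set Z" "length Z0 = length Z" "hd Z0 = z0"
      "set (tl Z0) = set Z - {z0}"
      using dcycle_rotate[of E as "z0 # rest"] Z by (auto simp: Z0_def split)
    from greedy_step.IH obtain D C where DC: "\<And>v. rooted_cactus E L v (K\<^sup>* `` {v}) (D v) (C v)"
      by metis
    define rep where "rep v = (THE z. z \<in> set Z \<and> (z, v) \<in> K\<^sup>*)" for v
    have rep: "rep v = z" if "z \<in> set Z" "(z, v) \<in> K\<^sup>*" for v z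
      unfolding rep_def by (rule the_equality) (use that indep symK in \<open>blast intro: rtrancl_trans\<close>)+
    define depth where "depth v = (if (r, v) \<in> K\<^sup>* then D r v else Suc (D r z0) + D (rep v) v)" for v
    define cyc where
      "cyc v = (if (r, v) \<in> K\<^sup>* then C r v else if v = rep v then Z0 else C (rep v) v)" for v
    interpret R: rooted_cactus E L r "K\<^sup>* `` {r}" "D r" "C r" by (rule DC)
    have comp: "?K'\<^sup>* `` {r} = {v. (r, v) \<in> K\<^sup>* \<or> (\<exists>z \<in> set Z. (z, v) \<in> K\<^sup>*)}"
    proof (intro set_eqI iffI)
      fix v assume "v \<in> ?K'\<^sup>* `` {r}"
      then show "v \<in> {v. (r, v) \<in> K\<^sup>* \<or> (\<exists>z \<in> set Z. (z, v) \<in> K\<^sup>*)}" using K'D by blast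
    next
      fix v assume "v \<in> {v. (r, v) \<in> K\<^sup>* \<or> (\<exists>z \<in> set Z. (z, v) \<in> K\<^sup>*)}"
      then show "v \<in> ?K'\<^sup>* `` {r}"
        using K'I K'Z[OF z0(1)] K'I[OF z0(2)] by (blast intro: rtrancl_trans)
    qed
    have far: "(r, v) \<notin> K\<^sup>*" if "z \<in> set Z" "z \<noteq> z0" "(z, v) \<in> K\<^sup>*" for z v
      using that indep[OF z0(1) that(1)] z0(2) symK by (blast intro: rtrancl_trans)
    have cases: "(r, v) \<in> K\<^sup>* \<and> cyc v = C r v \<or>
        v \<in> set Z - {z0} \<and> cyc v = Z0 \<or>
        (\<exists>z \<in> set Z - {z0}. (z, v) \<in> K\<^sup>* \<and> v \<noteq> z \<and> cyc v = C z v)"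
      if v: "v \<in> ?K'\<^sup>* `` {r}" for v
    proof (cases "(r, v) \<in> K\<^sup>*")
      case False
      then obtain z where z: "z \<in> set Z" "(z, v) \<in> K\<^sup>*" using v comp by auto
      moreover have "z \<noteq> z0" using False z z0(2) by (auto intro: rtrancl_trans)
      ultimately show ?thesis using False rep[OF z] by (auto simp: cyc_def)
    qed (simp add: cyc_def)
    have inZ: "depth u = Suc (depth z0)" "cyc u = Z0" "u \<noteq> r" if u: "u \<in> set Z - {z0}" for u
    proof -
      interpret U: rooted_cactus E L u "K\<^sup>* `` {u}" "D u" "C u" by (rule DC)
      have "(r, u) \<notin> K\<^sup>*" "rep u = u" using far[of u u] rep[of u u] u by auto
      then show "depth u = Suc (depth z0)" "cyc u = Z0" "u \<noteq> r"
        using z0(2) U.root by (auto simp: depth_def cyc_def)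
    qed
    have old: "depth u = D r u" "cyc u = C r u" if "(r, u) \<in> K\<^sup>*" for u
      using that by (simp_all add: depth_def cyc_def)
    have new: "depth u = Suc (D r z0) + D z u" "u \<noteq> z \<Longrightarrow> cyc u = C z u" "u \<noteq> r"
      if "z \<in> set Z - {z0}" "(z, u) \<in> K\<^sup>*" for u z
      using far[of z u] rep[of z u] that by (auto simp: depth_def cyc_def)
    have "rooted_cactus E L r (?K'\<^sup>* `` {r}) depth cyc"
    proof
      show "r \<in> ?K'\<^sup>* `` {r}" by simp
      show "depth r = 0" using old(1)[of r] R.root by simp
    next
      fix v assume v: "v \<in> ?K'\<^sup>* `` {r}" "v \<noteq> r"
      have "dcycle E (cyc v) \<and> L \<le> length (cyc v) \<and> set (cyc v) \<subseteq> ?K'\<^sup>* `` {r} \<and>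
        v \<in> set (tl (cyc v)) \<and>
        (\<forall>u \<in> set (tl (cyc v)). u \<noteq> r \<and> cyc u = cyc v \<and> depth u = Suc (depth (hd (cyc v))))"
        using cases[OF v(1)]
      proof (elim disjE conjE bexE)
        assume rv: "(r, v) \<in> K\<^sup>*" "cyc v = C r v"
        then have vP: "v \<in> K\<^sup>* `` {r}" by simp
        have sub: "set (C r v) \<subseteq> K\<^sup>* `` {r}" using R.cyc(3)[OF vP v(2)] .
        have ne: "C r v \<noteq> []" using R.cyc(4)[OF vP v(2)] by auto
        then have hd: "hd (C r v) \<in> K\<^sup>* `` {r}" using sub hd_in_set by blast
        have tl: "set (tl (C r v)) \<subseteq> K\<^sup>* `` {r}" using sub ne by (cases "C r v") auto
        show ?thesis
          unfolding rv(2)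
        proof (intro conjI ballI)
          show "dcycle E (C r v)" "L \<le> length (C r v)" "v \<in> set (tl (C r v))"
            using R.cyc[OF vP v(2)] by blast+
          show "set (C r v) \<subseteq> ?K'\<^sup>* `` {r}" using sub K'I by blast
          fix u assume u: "u \<in> set (tl (C r v))"
          then have ru: "(r, u) \<in> K\<^sup>*" "(r, hd (C r v)) \<in> K\<^sup>*" using tl hd by auto
          show "u \<noteq> r" "cyc u = C r v" "depth u = Suc (depth (hd (C r v)))"
            using R.below[OF vP v(2) u] old(2)[OF ru(1)] old(1)[OF ru(1)] old(1)[OF ru(2)] by simp_all
        qed
      next
        assume vZ: "v \<in> set Z - {z0}" "cyc v = Z0"
        have "set Z \<subseteq> ?K'\<^sup>* `` {r}" using K'Z[OF z0(1)] K'I[OF z0(2)] by (auto intro: rtrancl_trans)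
        then show ?thesis
          unfolding vZ(2)
        proof (intro conjI ballI)
          show "dcycle E Z0" "L \<le> length Z0" "v \<in> set (tl Z0)"
            using Z0 vZ(1) greedy_step.hyps(3) by auto
          show "set Z0 \<subseteq> ?K'\<^sup>* `` {r}" using \<open>set Z \<subseteq> ?K'\<^sup>* `` {r}\<close> Z0(2) by simp
          fix u assume "u \<in> set (tl Z0)"
          then have "u \<in> set Z - {z0}" using Z0(5) by simp
          then show "u \<noteq> r" "cyc u = Z0" "depth u = Suc (depth (hd Z0))"
            using inZ Z0(4) by auto
        qed
      next
        fix z assume z: "z \<in> set Z - {z0}" "(z, v) \<in> K\<^sup>*" "v \<noteq> z" "cyc v = C z v"
        interpret U: rooted_cactus E L z "K\<^sup>* `` {z}" "D z" "C z" by (rule DC)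
        have vP: "v \<in> K\<^sup>* `` {z}" using z by simp
        have sub: "set (C z v) \<subseteq> K\<^sup>* `` {z}" using U.cyc(3)[OF vP z(3)] .
        have ne: "C z v \<noteq> []" using U.cyc(4)[OF vP z(3)] by auto
        then have hd: "hd (C z v) \<in> K\<^sup>* `` {z}" using sub hd_in_set by blast
        have tl: "set (tl (C z v)) \<subseteq> K\<^sup>* `` {z}" using sub ne by (cases "C z v") auto
        have "K\<^sup>* `` {z} \<subseteq> ?K'\<^sup>* `` {r}" using comp z(1) by auto
        then show ?thesis
          unfolding z(4)
        proof (intro conjI ballI)
          show "dcycle E (C z v)" "L \<le> length (C z v)" "v \<in> set (tl (C z v))"
            using U.cyc[OF vP z(3)] by blast+
          show "set (C z v) \<subseteq> ?K'\<^sup>* `` {r}"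
            using sub \<open>K\<^sup>* `` {z} \<subseteq> ?K'\<^sup>* `` {r}\<close> by (rule subset_trans)
          fix u assume u: "u \<in> set (tl (C z v))"
          then have zu: "(z, u) \<in> K\<^sup>*" "(z, hd (C z v)) \<in> K\<^sup>*" using tl hd by auto
          show "u \<noteq> r" "cyc u = C z v" "depth u = Suc (depth (hd (C z v)))"
            using U.below[OF vP z(3) u] new[OF z(1) zu(1)] new(1)[OF z(1) zu(2)] by simp_all
        qed
      qed
      then show "dcycle E (cyc v)" "L \<le> length (cyc v)" "set (cyc v) \<subseteq> ?K'\<^sup>* `` {r}"
        "v \<in> set (tl (cyc v))"
        "\<And>u. u \<in> set (tl (cyc v)) \<Longrightarrow> u \<noteq> r \<and> cyc u = cyc v \<and> depth u = Suc (depth (hd (cyc v)))"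
        by blast+
    qed
    then show ?thesis by blast
  qed
qed

context rooted_cactus
begin

definition arcs_on_cycles :: "('v \<times> 'v) set" where
  "arcs_on_cycles = (\<Union>v \<in> P - {r}. cycle_arcs (cyc v))"

text \<open>
  This is the number of steps from the top of the cycle to \<open>v\<close>.
\<close>

definition pos :: "'v \<Rightarrow> nat" where
  "pos v = length (takeWhile (\<lambda>u. u \<noteq> v) (cyc v))"

lemma arcs_on_cycles_subset: "arcs_on_cycles \<subseteq> E"
  using cyc(1) by (auto simp: arcs_on_cycles_def dcycle_iff_cycle_arcs)

lemma depth_Suc: "v \<in> P \<Longrightarrow> v \<noteq> r \<Longrightarrow> depth v = Suc (depth (hd (cyc v)))"
  using below cyc(4) by blast

lemma cyc_split:
  assumes "v \<in> P" "v \<noteq> r"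
  obtains t as bs where "cyc v = t # as @ v # bs" "t \<in> P" "depth v = Suc (depth t)"
    "\<And>u. u \<in> set as \<union> set bs \<Longrightarrow> depth u = depth v \<and> cyc u = cyc v \<and> u \<noteq> v"
    "dpath E (t # as @ [v])" "dpath E (v # bs @ [t])"
    "pos v = Suc (length as)" "L \<le> length as + length bs + 2"
proof -
  obtain t Z where tZ: "cyc v = t # Z" using cyc(4)[OF assms] by (cases "cyc v") auto
  obtain as bs where Z: "Z = as @ v # bs" using cyc(4)[OF assms] by (auto simp: tZ dest: split_list)
  have C: "dcycle E (t # as @ v # bs)" using cyc(1)[OF assms] by (simp add: tZ Z)
  then have dist: "distinct (t # as @ v # bs)" by (simp add: dcycle_def dpath_def)
  have d: "depth v = Suc (depth t)" using depth_Suc[OF assms] by (simp add: tZ)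
  show ?thesis
  proof (rule that)
    show "cyc v = t # as @ v # bs" by (simp add: tZ Z)
    show "t \<in> P" using cyc(3)[OF assms] by (simp add: tZ)
    show "depth v = Suc (depth t)" by (fact d)
    show "depth u = depth v \<and> cyc u = cyc v \<and> u \<noteq> v" if "u \<in> set as \<union> set bs" for u
      using below[OF assms, of u] that d dist by (auto simp: tZ Z)
    have "dpath E ((t # as @ [v]) @ bs)" using C by (simp add: dcycle_def)
    then show "dpath E (t # as @ [v])"
      unfolding dpath_def using walk_appendD1[of E "t # as @ [v]" bs] by auto
    have "dcycle E ((v # bs) @ (t # as))" using dcycle_rotate[of E "t # as" "v # bs"] C by simp
    then have "dpath E ((v # bs @ [t]) @ as)" by (simp add: dcycle_def)
    then show "dpath E (v # bs @ [t])"
      unfolding dpath_def using walk_appendD1[of E "v # bs @ [t]" as] by auto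
    have "takeWhile (\<lambda>u. u \<noteq> v) (as @ v # bs) = as"
      using dist by (subst takeWhile_append2) auto
    then show "pos v = Suc (length as)" using dist by (simp add: pos_def tZ Z)
    show "L \<le> length as + length bs + 2" using cyc(2)[OF assms] by (simp add: tZ Z)
  qed
qed

lemma depth_on_cycle:
  assumes "v \<in> P" "v \<noteq> r" "u \<in> set (cyc v)"
  shows "u = hd (cyc v) \<or> depth u = depth v" "u \<in> P" "depth u \<le> depth v" "depth v \<le> Suc (depth u)"
proof -
  show 1: "u = hd (cyc v) \<or> depth u = depth v"
    using below[OF assms(1,2), of u] depth_Suc[OF assms(1,2)] assms(3) by (cases "cyc v") auto
  show "u \<in> P" using cyc(3)[OF assms(1,2)] assms(3) by blast
  show "depth u \<le> depth v" "depth v \<le> Suc (depth u)" using 1 depth_Suc[OF assms(1,2)] by auto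
qed

text \<open>
  An arc on the cycles changes the depth by at most one, so differences of depth bound
  lengths of paths from below.
\<close>

lemma depth_walk:
  assumes "walk arcs_on_cycles p"
  shows "depth (hd p) < depth (last p) + length p" "depth (last p) < depth (hd p) + length p"
proof -
  have arc: "depth a \<le> Suc (depth b) \<and> depth b \<le> Suc (depth a)" if ab: "(a, b) \<in> arcs_on_cycles" for a b
  proof -
    obtain v where v: "v \<in> P" "v \<noteq> r" "(a, b) \<in> cycle_arcs (cyc v)"
      using ab by (auto simp: arcs_on_cycles_def)
    then have "a \<in> set (cyc v)" "b \<in> set (cyc v)" using cycle_arcs_subset by fastforce+
    then show ?thesis using depth_on_cycle[OF v(1,2)] by (meson le_trans not_less_eq_eq Suc_le_mono)
  qed
  from assms have "depth (hd p) < depth (last p) + length p \<and> depth (last p) < depth (hd p) + length p"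
  proof (induction p)
    case (Cons a p)
    then show ?case using arc[of a "hd p"] by (cases "p = []") (auto simp: walk_Cons)
  qed simp
  then show "depth (hd p) < depth (last p) + length p" "depth (last p) < depth (hd p) + length p"
    by blast+
qed

lemma path_within:
  assumes "(u, v) \<in> (arcs_on_cycles \<inter> A \<times> A)\<^sup>*" "u \<in> A"
  obtains p where "dpath arcs_on_cycles p" "hd p = u" "last p = v" "set p \<subseteq> A"
proof -
  obtain p where p: "dpath (arcs_on_cycles \<inter> A \<times> A) p" "hd p = u" "last p = v"
    using rtrancl_imp_dpath[OF assms(1)] by blast
  have "x \<in> A" if "(u, x) \<in> (arcs_on_cycles \<inter> A \<times> A)\<^sup>*" for x
    using that by (induction rule: rtrancl_induct) (use assms(2) in auto)
  then have "set p \<subseteq> A" using p walk_imp_rtrancl by (metis dpath_def subsetI)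
  moreover have "dpath arcs_on_cycles p" using p(1) walk_mono by (auto simp: dpath_def)
  ultimately show ?thesis using that p by blast
qed

lemma cycle_within:
  assumes "v \<in> P" "v \<noteq> r" "set (cyc v) \<subseteq> A" "a \<in> set (cyc v)" "b \<in> set (cyc v)"
  shows "(a, b) \<in> (arcs_on_cycles \<inter> A \<times> A)\<^sup>*"
proof -
  have "(a, b) \<in> (cycle_arcs (cyc v))\<^sup>*"
    using cyc(1)[OF assms(1,2)] assms by (intro cycle_arcs_connect) (auto simp: dcycle_iff_cycle_arcs)
  moreover have "cycle_arcs (cyc v) \<subseteq> arcs_on_cycles \<inter> A \<times> A"
    using cycle_arcs_subset[of "cyc v"] assms(1-3) by (auto simp: arcs_on_cycles_def)
  ultimately show ?thesis using rtrancl_mono by blast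
qed

text \<open>
  Each vertex can go to the top of its cycle and back, hence to the root and back, without increasing
  the depth.
\<close>

lemma low_path:
  assumes "u \<in> P" "v \<in> P" "depth u \<le> d" "depth v \<le> d"
  obtains p where "dpath E p" "hd p = u" "last p = v" "\<And>x. x \<in> set p \<Longrightarrow> depth x \<le> d"
proof -
  define A where "A = {x \<in> P. depth x \<le> d}"
  have to_root: "(x, r) \<in> (arcs_on_cycles \<inter> A \<times> A)\<^sup>* \<and> (r, x) \<in> (arcs_on_cycles \<inter> A \<times> A)\<^sup>*"
    if "x \<in> A" for x
    using that
  proof (induction "depth x" arbitrary: x rule: less_induct)
    case less
    show ?case
    proof (cases "x = r")
      case False
      have x: "x \<in> P" "x \<noteq> r" "depth x \<le> d" using less.prems False by (auto simp: A_def)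
      have hd: "hd (cyc x) \<in> set (cyc x)" "x \<in> set (cyc x)"
        using cyc(4)[OF x(1,2)] by (cases "cyc x"; auto)+
      have sub: "set (cyc x) \<subseteq> A" using depth_on_cycle[OF x(1,2)] x(3) by (force simp: A_def)
      have "(hd (cyc x), r) \<in> (arcs_on_cycles \<inter> A \<times> A)\<^sup>* \<and> (r, hd (cyc x)) \<in> (arcs_on_cycles \<inter> A \<times> A)\<^sup>*"
        using less.hyps[of "hd (cyc x)"] depth_Suc[OF x(1,2)] sub hd(1) by auto
      then show ?thesis
        using cycle_within[OF x(1,2) sub] hd by (meson rtrancl_trans)
    qed simp
  qed
  have "u \<in> A" "v \<in> A" using assms by (auto simp: A_def)
  then have "(u, v) \<in> (arcs_on_cycles \<inter> A \<times> A)\<^sup>*" using to_root by (meson rtrancl_trans)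
  then obtain p where p: "dpath arcs_on_cycles p" "hd p = u" "last p = v" "set p \<subseteq> A"
    using path_within \<open>u \<in> A\<close> by blast
  show ?thesis
    by (rule that[OF _ p(2,3)]) (use p(1,4) arcs_on_cycles_subset walk_mono in \<open>auto simp: dpath_def A_def\<close>)
qed

text \<open>
  Climbing from \<open>y\<close> towards the root, the first vertex \<open>z\<close> of depth \<open>m\<close> separates \<open>y\<close> from the
  part above it: it can be reached from \<open>y\<close>, and \<open>y\<close> from it, below depth \<open>m\<close>.
\<close>

lemma ancestor:
  assumes "y \<in> P" "depth y = m + n"
  obtains z p q where "z \<in> P" "depth z = m"
    "dpath E p" "hd p = y" "last p = z" "n < length p" "\<And>x. x \<in> set p \<Longrightarrow> x \<noteq> z \<Longrightarrow> m < depth x"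
    "dpath E q" "hd q = z" "last q = y" "n < length q" "\<And>x. x \<in> set q \<Longrightarrow> x \<noteq> z \<Longrightarrow> m < depth x"
proof -
  define A where "A z = {x \<in> P. x = z \<or> m < depth x}" for z
  have "\<exists>z \<in> P. depth z = m \<and> (y, z) \<in> (arcs_on_cycles \<inter> A z \<times> A z)\<^sup>* \<and>
      (z, y) \<in> (arcs_on_cycles \<inter> A z \<times> A z)\<^sup>*"
    using assms
  proof (induction n arbitrary: y)
    case (Suc n)
    have y: "y \<in> P" "y \<noteq> r" using Suc.prems root by auto
    have hd: "hd (cyc y) \<in> set (cyc y)" "y \<in> set (cyc y)"
      using cyc(4)[OF y] by (cases "cyc y"; auto)+
    have d: "depth (hd (cyc y)) = m + n" using depth_Suc[OF y] Suc.prems by simp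
    then obtain z where z: "z \<in> P" "depth z = m" "(hd (cyc y), z) \<in> (arcs_on_cycles \<inter> A z \<times> A z)\<^sup>*"
      "(z, hd (cyc y)) \<in> (arcs_on_cycles \<inter> A z \<times> A z)\<^sup>*"
      using Suc.IH[of "hd (cyc y)"] depth_on_cycle(2)[OF y hd(1)] by blast
    have "hd (cyc y) = z \<or> m < depth (hd (cyc y))"
    proof (cases n)
      case 0
      have "hd (cyc y) \<notin> A z \<or> hd (cyc y) = z" using d 0 by (auto simp: A_def)
      then show ?thesis using z(3) by (auto elim: converse_rtranclE)
    qed (use d in simp)
    then have sub: "set (cyc y) \<subseteq> A z"
      using depth_on_cycle(1,2)[OF y] Suc.prems(2) unfolding A_def by force
    have "(y, z) \<in> (arcs_on_cycles \<inter> A z \<times> A z)\<^sup>*"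
      using cycle_within[OF y sub hd(2,1)] z(3) by (rule rtrancl_trans)
    moreover have "(z, y) \<in> (arcs_on_cycles \<inter> A z \<times> A z)\<^sup>*"
      using z(4) cycle_within[OF y sub hd] by (rule rtrancl_trans)
    ultimately show ?case using z(1,2) by blast
  qed auto
  then obtain z where z: "z \<in> P" "depth z = m" "(y, z) \<in> (arcs_on_cycles \<inter> A z \<times> A z)\<^sup>*"
    "(z, y) \<in> (arcs_on_cycles \<inter> A z \<times> A z)\<^sup>*" by blast
  have "z \<in> A z" using z(1) by (simp add: A_def)
  moreover have "y \<in> A z" using z(4) calculation by (auto elim: rtranclE)
  ultimately obtain p q where p: "dpath arcs_on_cycles p" "hd p = y" "last p = z" "set p \<subseteq> A z"
    and q: "dpath arcs_on_cycles q" "hd q = z" "last q = y" "set q \<subseteq> A z"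
    using path_within z(3,4) by metis
  have "n < length p" "n < length q"
    using depth_walk[of p] depth_walk[of q] p q assms(2) z(2) by (auto simp: dpath_def)
  moreover have "dpath E p" "dpath E q"
    using p(1) q(1) arcs_on_cycles_subset walk_mono by (auto simp: dpath_def)
  ultimately show ?thesis using that[OF z(1,2)] p q by (auto simp: A_def)
qed

text \<open>
  Let \<open>z\<close> be the ancestor of \<open>y\<close> one level below \<open>x\<close>. Below \<open>z\<close> there are paths \<open>U\<close>
  from \<open>y\<close> to \<open>z\<close> and \<open>D\<close> from \<open>z\<close> to \<open>y\<close> with at least \<open>l\<close> arcs. Above, there are paths \<open>V\<close>
  from \<open>x\<close> to \<open>z\<close> and \<open>W\<close> from \<open>z\<close> to \<open>x\<close> that use the two complementary stretches of the cycle of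
  \<open>z\<close>. One of these stretches has at least \<open>k\<close> arcs since the cycle has length at least \<open>2 k - 1\<close>.
  An arc between \<open>x\<close> and \<open>y\<close> prolongs one of the four paths and completes a spindle with ends
  among \<open>x\<close>, \<open>y\<close> and \<open>z\<close>.
\<close>

lemma arcs_join_near_depths:
  assumes free: "spindle_free E k l" and L: "2 * k - 1 \<le> L" and k: "1 \<le> l" "l \<le> k"
    and xy: "x \<in> P" "y \<in> P" "depth x + l < depth y"
  shows "(x, y) \<notin> E" "(y, x) \<notin> E"
proof -
  define n where "n = depth y - Suc (depth x)"
  have n: "depth y = Suc (depth x) + n" "l \<le> n" using xy(3) by (auto simp: n_def)
  obtain z U D where z: "z \<in> P" "depth z = Suc (depth x)"
    and U: "dpath E U" "hd U = y" "last U = z" "n < length U"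
      "\<And>v. v \<in> set U \<Longrightarrow> v \<noteq> z \<Longrightarrow> Suc (depth x) < depth v"
    and D: "dpath E D" "hd D = z" "last D = y" "n < length D"
      "\<And>v. v \<in> set D \<Longrightarrow> v \<noteq> z \<Longrightarrow> Suc (depth x) < depth v"
    by (rule ancestor[OF xy(2) n(1)]) (rule that; blast)
  have "z \<noteq> r" using z root by auto
  obtain t as bs where cs: "cyc z = t # as @ z # bs" "t \<in> P" "depth z = Suc (depth t)"
    "\<And>u. u \<in> set as \<union> set bs \<Longrightarrow> depth u = depth z \<and> cyc u = cyc z \<and> u \<noteq> z"
    "dpath E (t # as @ [z])" "dpath E (z # bs @ [t])" "pos z = Suc (length as)"
    "L \<le> length as + length bs + 2"
    by (rule cyc_split[OF z(1) \<open>z \<noteq> r\<close>]) (rule that; blast)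
  have dt: "depth t = depth x" using cs(3) z(2) by simp
  obtain X where X: "dpath E X" "hd X = x" "last X = t" "\<And>v. v \<in> set X \<Longrightarrow> depth v \<le> depth x"
    using low_path[OF xy(1) cs(2), of "depth x"] dt by auto
  obtain Y where Y: "dpath E Y" "hd Y = t" "last Y = x" "\<And>v. v \<in> set Y \<Longrightarrow> depth v \<le> depth x"
    using low_path[OF cs(2) xy(1), of "depth x"] dt by auto
  have ne: "X \<noteq> []" "Y \<noteq> []" "U \<noteq> []" "D \<noteq> []" using X(1) Y(1) U(1) D(1) by (auto dest: dpath_not_Nil)
  have up: "depth v = Suc (depth x)" if "v \<in> set as \<union> set bs \<union> {z}" for v
    using that cs(4) z(2) by auto
  have disj: "set X \<inter> (set as \<union> set bs \<union> {z}) = {}" "set Y \<inter> (set as \<union> set bs \<union> {z}) = {}"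
    using up X(4) Y(4) by fastforce+
  define V where "V = X @ as @ [z]"
  define W where "W = z # bs @ Y"
  have "dpath E (as @ [z])" "(t, hd (as @ [z])) \<in> E"
    using dpath_Cons[of "as @ [z]" E t] cs(5) by simp_all
  then have V: "dpath E V" "hd V = x" "last V = z" "length as + 1 < length V"
    using dpath_append[of X "as @ [z]" E] X(1-3) ne(1) disj(1) by (auto simp: V_def neq_Nil_conv)
  have "dpath E (z # bs)" "(last (z # bs), t) \<in> E"
    using dpath_append[of "z # bs" "[t]" E] cs(6) by simp_all
  then have W: "dpath E W" "hd W = z" "last W = x" "length bs + 1 < length W"
    using dpath_append[of "z # bs" Y E] Y(1-3) ne(2) disj(2) by (auto simp: W_def neq_Nil_conv)
  have far: "v \<notin> set U" "v \<notin> set D" if "v \<in> set V \<union> set W" "v \<noteq> z" for v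
  proof -
    have "depth v \<le> Suc (depth x)"
      using that up X(4) Y(4) by (fastforce simp: V_def W_def)
    then show "v \<notin> set U" "v \<notin> set D" using U(5) D(5) that(2) by fastforce+
  qed
  have xz: "x \<noteq> z" "x \<noteq> y" "y \<noteq> z"
    using z(2) n xy(3) k(1) by auto
  have mem: "x \<in> set V" "x \<in> set W" "y \<in> set U" "y \<in> set D"
    using V(1,2) W(1,3) U(1,2) D(1,3) hd_in_set last_in_set dpath_not_Nil by metis+
  have far': "y \<notin> set V" "y \<notin> set W" "x \<notin> set U" "x \<notin> set D"
    using far mem xz by blast+
  have "k \<le> length as + 1 \<or> k \<le> length bs + 1"
    using cs(8) L k by linarith
  then have "False" if "(x, y) \<in> E \<or> (y, x) \<in> E"
    using that
  proof (elim disjE)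
    assume *: "k \<le> length as + 1" "(x, y) \<in> E"
    show False
    proof (rule spindle_freeD[OF free, of V "x # U" x z])
      show "dpath E (x # U)" using U(1,2) ne far' * by (simp add: dpath_Cons)
      show "set V \<inter> set (x # U) \<subseteq> {x, z}" using far by auto
    qed (use V U ne n xz * in auto)
  next
    assume *: "k \<le> length as + 1" "(y, x) \<in> E"
    show False
    proof (rule spindle_freeD[OF free, of "y # V" U y z])
      show "dpath E (y # V)" using V(1,2) far' * dpath_not_Nil[OF V(1)] by (simp add: dpath_Cons)
      show "set (y # V) \<inter> set U \<subseteq> {y, z}" using far by auto
    qed (use V U ne n xz * dpath_not_Nil[OF V(1)] in auto)
  next
    assume *: "k \<le> length bs + 1" "(x, y) \<in> E"
    show False
    proof (rule spindle_freeD[OF free, of "W @ [y]" D z y])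
      show "dpath E (W @ [y])"
        using W(1,3) far' * dpath_not_Nil[OF W(1)] by (simp add: dpath_append) (simp add: dpath_def)
      show "set (W @ [y]) \<inter> set D \<subseteq> {z, y}" using far by auto
    qed (use W D ne n xz * dpath_not_Nil[OF W(1)] in auto)
  next
    assume *: "k \<le> length bs + 1" "(y, x) \<in> E"
    show False
    proof (rule spindle_freeD[OF free, of W "D @ [x]" z x])
      show "dpath E (D @ [x])"
        using D(1,3) far' * ne by (simp add: dpath_append) (simp add: dpath_def)
      show "set W \<inter> set (D @ [x]) \<subseteq> {z, x}" using far by auto
    qed (use W D ne n xz * in auto)
  qed
  then show "(x, y) \<notin> E" "(y, x) \<notin> E" by blast+
qed

text \<open>
  Let \<open>s\<close> and \<open>t\<close> be the tops of the cycles of \<open>x\<close> and \<open>y\<close>; they are joined in both directions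
  above these cycles. The first possible spindle leads from \<open>x\<close> to \<open>s\<close>: once along the cycle of
  \<open>x\<close>, and once over the arc \<open>(x, y)\<close>, along the cycle of \<open>y\<close> and from \<open>t\<close> to \<open>s\<close> (\<open>into\<close>). The
  second one leads from \<open>s\<close> to \<open>y\<close>, over \<open>x\<close> or over \<open>t\<close> (\<open>out\<close>). As a cycle of length at least
  \<open>2 k - 1\<close> is long before or after each of its vertices, one of them is present if \<open>x\<close> and \<open>y\<close> are both near the
  start of their cycles or both not near it.
\<close>

lemma arcs_join_ends:
  assumes free: "spindle_free E k l" and L: "2 * k - 1 \<le> L" and k: "1 \<le> k" "l \<le> k"
    and xy: "x \<in> P" "y \<in> P" "x \<noteq> r" "y \<noteq> r" "depth x = depth y" "cyc x \<noteq> cyc y" "(x, y) \<in> E"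
  shows "(pos x < l) \<noteq> (pos y < l)"
proof -
  obtain s as bs where x: "cyc x = s # as @ x # bs" "s \<in> P" "depth x = Suc (depth s)"
    "\<And>u. u \<in> set as \<union> set bs \<Longrightarrow> depth u = depth x \<and> cyc u = cyc x \<and> u \<noteq> x"
    "dpath E (s # as @ [x])" "dpath E (x # bs @ [s])" "pos x = Suc (length as)"
    "L \<le> length as + length bs + 2"
    by (rule cyc_split[OF xy(1,3)]) (rule that; blast)
  obtain t cs ds where y: "cyc y = t # cs @ y # ds" "t \<in> P" "depth y = Suc (depth t)"
    "\<And>u. u \<in> set cs \<union> set ds \<Longrightarrow> depth u = depth y \<and> cyc u = cyc y \<and> u \<noteq> y"
    "dpath E (t # cs @ [y])" "dpath E (y # ds @ [t])" "pos y = Suc (length cs)"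
    "L \<le> length cs + length ds + 2"
    by (rule cyc_split[OF xy(2,4)]) (rule that; blast)
  have dst: "depth s = depth t" using x(3) y(3) xy(5) by simp
  obtain X where X: "dpath E X" "hd X = t" "last X = s" "\<And>v. v \<in> set X \<Longrightarrow> depth v \<le> depth t"
    using low_path[OF y(2) x(2), of "depth t"] dst by auto
  obtain Y where Y: "dpath E Y" "hd Y = s" "last Y = t" "\<And>v. v \<in> set Y \<Longrightarrow> depth v \<le> depth t"
    using low_path[OF x(2) y(2), of "depth t"] dst by auto
  have ne: "X \<noteq> []" "Y \<noteq> []" using X(1) Y(1) by (auto dest: dpath_not_Nil)
  have high: "depth v = Suc (depth t)" if "v \<in> set as \<union> set bs \<union> set cs \<union> set ds \<union> {x, y}" for v
    using that x(3,4) y(3,4) dst by auto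
  have low: "v \<notin> set X" "v \<notin> set Y" if "v \<in> set as \<union> set bs \<union> set cs \<union> set ds \<union> {x, y}" for v
    using high[OF that] X(4) Y(4) by fastforce+
  have disj: "(set as \<union> set bs \<union> {x}) \<inter> (set cs \<union> set ds \<union> {y}) = {}"
    using x(4) y(4) xy(6) by force
  have st: "s \<notin> set cs \<union> set ds \<union> {x, y}" "s \<notin> set as \<union> set bs"
    using high[of s] dst by auto
  have into: False if "k \<le> length bs + 1 \<and> l \<le> length ds + 2 \<or> l \<le> length bs + 1 \<and> k \<le> length ds + 2"
  proof -
    have "dpath E (y # ds)" "(last (y # ds), t) \<in> E"
      using dpath_append[of "y # ds" "[t]" E] y(6) by simp_all
    then have "dpath E ((y # ds) @ X)"
      using dpath_append[of "y # ds" X E] X(1,2) ne(1) low(1) by auto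
    moreover have "x \<notin> set ((y # ds) @ X)" using disj low(1)[of x] by auto
    ultimately have 1: "dpath E (x # (y # ds) @ X)" using xy(7) by (simp add: dpath_Cons)
    have 2: "set (x # bs @ [s]) \<inter> set (x # (y # ds) @ X) \<subseteq> {x, s}"
      using disj low(1) by auto
    have "x \<noteq> s" using st by auto
    have len: "length ds + 2 < length (x # (y # ds) @ X)" using ne(1) by (cases X) auto
    have len': "length (x # bs @ [s]) = length bs + 2" by simp
    have last: "last (x # (y # ds) @ X) = s" using ne(1) X(3) by simp
    show False
      using that
    proof
      assume "k \<le> length bs + 1 \<and> l \<le> length ds + 2"
      with len len' show False
        by (intro spindle_freeD[OF free x(6) 1 _ _ _ last \<open>x \<noteq> s\<close> 2]) (linarith | simp)+
    next
      assume "l \<le> length bs + 1 \<and> k \<le> length ds + 2"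
      then show False
        using len len' 2
        by (intro spindle_freeD[OF free 1 x(6) _ _ last _ \<open>x \<noteq> s\<close>]) (linarith | blast | simp)+
    qed
  qed
  have out: False if "k \<le> length as + 2 \<and> l \<le> length cs + 1 \<or> l \<le> length as + 2 \<and> k \<le> length cs + 1"
  proof -
    have "y \<notin> set (s # as @ [x])" using disj st by auto
    then have 1: "dpath E ((s # as @ [x]) @ [y])"
      using dpath_append[of "s # as @ [x]" "[y]" E] x(5) xy(7) by (simp add: dpath_def[of E "[y]"])
    have "dpath E (cs @ [y])" "(t, hd (cs @ [y])) \<in> E"
      using dpath_Cons[of "cs @ [y]" E t] y(5) by simp_all
    then have 2: "dpath E (Y @ cs @ [y])"
      using dpath_append[of Y "cs @ [y]" E] Y(1,3) ne(2) low(2) by auto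
    have 3: "set ((s # as @ [x]) @ [y]) \<inter> set (Y @ cs @ [y]) \<subseteq> {s, y}"
      using disj low(2) by auto
    have "s \<noteq> y" using st by auto
    have len: "length cs + 1 < length (Y @ cs @ [y])" using ne(2) by (cases Y) auto
    have len': "length ((s # as @ [x]) @ [y]) = length as + 3" by simp
    have hd: "hd (Y @ cs @ [y]) = s" using ne(2) Y(2) by simp
    show False
      using that
    proof
      assume "k \<le> length as + 2 \<and> l \<le> length cs + 1"
      then show False
        using len len'
        by (intro spindle_freeD[OF free 1 2 _ hd _ _ \<open>s \<noteq> y\<close> 3]) (linarith | simp)+
    next
      assume "l \<le> length as + 2 \<and> k \<le> length cs + 1"
      then show False
        using len len' 3
        by (intro spindle_freeD[OF free 2 1 hd _ _ _ \<open>s \<noteq> y\<close>]) (linarith | blast | simp)+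
    qed
  qed
  show ?thesis
  proof (rule ccontr)
    assume "\<not> ?thesis"
    then consider "pos x < l" "pos y < l" | "l \<le> pos x" "l \<le> pos y" by linarith
    then show False
    proof cases
      case 1
      then show ?thesis using into x(7,8) y(7,8) L k by linarith
    next
      case 2
      have "k \<le> length as + 2 \<or> k \<le> length cs + 1 \<or> k \<le> length bs + 1 \<and> l \<le> length ds + 2"
        using x(8) y(8) L k by linarith
      then show ?thesis using into out 2 x(7) y(7) by linarith
    qed
  qed
qed

end

section \<open>Chords of a path\<close>

lemma mod_eq_gap:
  fixes a b k :: nat
  assumes "a < b" "a mod k = b mod k"
  shows "a + k \<le> b"
proof -
  have "k dvd b - a" using assms mod_eq_dvd_iff_nat[of a b k] by simp
  then have "k \<le> b - a" using assms by (intro dvd_imp_le) auto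
  then show ?thesis using assms by simp
qed

definition crossing_free :: "nat set \<Rightarrow> (nat \<Rightarrow> nat \<Rightarrow> bool) \<Rightarrow> bool" where
  "crossing_free S adj \<longleftrightarrow>
     (\<forall>a \<in> S. \<forall>b \<in> S. \<forall>c \<in> S. \<forall>d \<in> S. a < b \<and> b < c \<and> c < d \<longrightarrow> \<not> (adj a c \<and> adj b d))"

text \<open>
  Below a shortest chord that jumps over an element of \<open>S\<close>, every chord joins neighbouring
  elements of \<open>S\<close>, and no chord leads out from under it. Without such a chord, all chords join
  neighbouring elements.
\<close>

lemma crossing_free_degree:
  assumes fin: "finite S" and ne: "S \<noteq> {}" and symp: "symp adj" and irreflp: "irreflp adj"
    and free: "crossing_free S adj"
  obtains s where "s \<in> S" "card {u \<in> S. adj s u} \<le> 2"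
proof -
  have sym: "adj b a" if "adj a b" for a b using symp that by (rule sympD)
  have irrefl: "\<not> adj a a" for a using irreflp by (auto dest: irreflpD)
  have noncross: False if "a \<in> S" "b \<in> S" "c \<in> S" "d \<in> S" "a < b" "b < c" "c < d" "adj a c" "adj b d"
    for a b c d using free that unfolding crossing_free_def by blast
  define pred where "pred s = {u \<in> S. u < s \<and> (\<forall>w \<in> S. \<not> (u < w \<and> w < s))}" for s
  define succ where "succ s = {u \<in> S. s < u \<and> (\<forall>w \<in> S. \<not> (s < w \<and> w < u))}" for s
  have "\<exists>s \<in> S. \<forall>u \<in> S. adj s u \<longrightarrow> u \<in> pred s \<union> succ s"
  proof (cases "\<exists>x \<in> S. \<exists>y \<in> S. adj x y \<and> (\<exists>s \<in> S. x < s \<and> s < y)")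
    case False
    have "u \<in> pred s \<union> succ s" if "s \<in> S" "u \<in> S" "adj s u" for s u
    proof -
      have "u \<noteq> s" using irrefl that(3) by auto
      then consider "u < s" | "s < u" by linarith
      then show ?thesis
      proof cases
        case 1
        then have "\<forall>w \<in> S. \<not> (u < w \<and> w < s)" using False that sym by blast
        with 1 that show ?thesis by (simp add: pred_def)
      next
        case 2
        then have "\<forall>w \<in> S. \<not> (s < w \<and> w < u)" using False that by blast
        with 2 that show ?thesis by (simp add: succ_def)
      qed
    qed
    with ne show ?thesis by blast
  next
    case True
    define Q where "Q e \<longleftrightarrow> (case e of (x, y) \<Rightarrow> x \<in> S \<and> y \<in> S \<and> adj x y \<and> (\<exists>s \<in> S. x < s \<and> s < y))" for e
    from True obtain e0 where "Q e0" by (auto simp: Q_def)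
    then obtain e where e: "Q e" "\<And>e'. Q e' \<Longrightarrow> snd e - fst e \<le> snd e' - fst e'"
      using ex_has_least_nat[of Q e0 "\<lambda>e. snd e - fst e"] by auto
    obtain x y where xy: "e = (x, y)" by (cases e)
    obtain s where s: "s \<in> S" "x < s" "s < y" "x \<in> S" "y \<in> S" "adj x y"
      using e(1) by (auto simp: Q_def xy)
    have "u \<in> pred s \<union> succ s" if u: "u \<in> S" "adj s u" for u
    proof -
      have "x \<le> u" using noncross[of u x s y] u s sym by (meson not_le)
      moreover have "u \<le> y" using noncross[of x s y u] u s by (meson not_le)
      moreover have "u \<noteq> s" using irrefl u(2) by metis
      moreover have "\<not> (u < w \<and> w < s)" if "w \<in> S" for w
      proof
        assume uw: "u < w \<and> w < s"
        then have "Q (u, s)" using u s sym that by (auto simp: Q_def)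
        from e(2)[OF this] have "y - x \<le> s - u" by (simp add: xy)
        then show False using uw s(2,3) \<open>x \<le> u\<close> by linarith
      qed
      moreover have "\<not> (s < w \<and> w < u)" if "w \<in> S" for w
      proof
        assume uw: "s < w \<and> w < u"
        then have "Q (s, u)" using u s that by (auto simp: Q_def)
        from e(2)[OF this] have "y - x \<le> u - s" by (simp add: xy)
        then show False using uw s(2,3) \<open>u \<le> y\<close> by linarith
      qed
      ultimately show ?thesis using u unfolding pred_def succ_def by auto
    qed
    with s(1) show ?thesis by blast
  qed
  then obtain s where s: "s \<in> S" "{u \<in> S. adj s u} \<subseteq> pred s \<union> succ s" by blast
  have finps: "finite (pred s)" "finite (succ s)" using fin by (auto simp: pred_def succ_def)
  have "u = w" if "u \<in> pred s" "w \<in> pred s" for u w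
    using that by (cases u w rule: linorder_cases) (auto simp: pred_def)
  moreover have "u = w" if "u \<in> succ s" "w \<in> succ s" for u w
    using that by (cases u w rule: linorder_cases) (auto simp: succ_def)
  ultimately have "card (pred s) \<le> Suc 0" "card (succ s) \<le> Suc 0"
    using finps by (simp_all add: card_le_Suc0_iff_eq)
  then have "card (pred s \<union> succ s) \<le> 2" using card_Un_le[of "pred s" "succ s"] by linarith
  then have "card {u \<in> S. adj s u} \<le> 2"
    using card_mono[OF finite_UnI[OF finps] s(2)] by linarith
  with s(1) show ?thesis using that by blast
qed

lemma crossing_free_three_colouring:
  assumes "finite S" "crossing_free S adj" and symp: "symp adj" and irreflp: "irreflp adj"
  shows "\<exists>g :: nat \<Rightarrow> nat. (\<forall>a. g a < 3) \<and> (\<forall>a \<in> S. \<forall>b \<in> S. adj a b \<longrightarrow> g a \<noteq> g b)"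
  using assms(1,2)
proof (induction S rule: finite_psubset_induct)
  case (psubset S)
  show ?case
  proof (cases "S = {}")
    case False
    obtain s where s: "s \<in> S" "card {u \<in> S. adj s u} \<le> 2"
      using crossing_free_degree[OF psubset.hyps(1) False symp irreflp psubset.prems] by blast
    have "S - {s} \<subset> S" "crossing_free (S - {s}) adj"
      using s(1) psubset.prems by (auto simp: crossing_free_def)
    from psubset.IH[OF this] obtain g :: "nat \<Rightarrow> nat" where g: "\<And>a. g a < 3"
      "\<And>a b. a \<in> S - {s} \<Longrightarrow> b \<in> S - {s} \<Longrightarrow> adj a b \<Longrightarrow> g a \<noteq> g b"
      by blast
    have "card (g ` {u \<in> S. adj s u}) < card {..<3 :: nat}"
      using s(2) card_image_le[of "{u \<in> S. adj s u}" g] psubset.hyps(1) by simp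
    moreover have "finite (g ` {u \<in> S. adj s u})" using psubset.hyps(1) by simp
    ultimately have "\<not> {..<3} \<subseteq> g ` {u \<in> S. adj s u}"
      using card_mono[of "g ` {u \<in> S. adj s u}" "{..<3}"] by linarith
    then obtain c where c: "c < 3" "c \<notin> g ` {u \<in> S. adj s u}" by auto
    show ?thesis
    proof (intro exI conjI allI ballI impI)
      show "(g(s := c)) a < 3" for a using g(1) c(1) by simp
      fix a b assume ab: "a \<in> S" "b \<in> S" "adj a b"
      have ba: "adj b a" using symp ab(3) by (rule sympD)
      have "a \<noteq> b" using ab(3) irreflp by (auto dest: irreflpD)
      then consider "a = s" "b \<noteq> s" | "a \<noteq> s" "b = s" | "a \<noteq> s" "b \<noteq> s" by blast
      then show "(g(s := c)) a \<noteq> (g(s := c)) b"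
      proof cases
        case 1
        then show ?thesis using ab c(2) by auto
      next
        case 2
        then show ?thesis using ab ba c(2) by auto
      next
        case 3
        then show ?thesis using ab g(2) by simp
      qed
    qed
  qed (rule exI[of _ "\<lambda>_. 0"], simp)
qed

lemma dpath_segment:
  assumes "dpath E p" "i \<le> j" "j < length p"
  shows "dpath E (map ((!) p) [i..<Suc j])" "hd (map ((!) p) [i..<Suc j]) = p ! i"
    "last (map ((!) p) [i..<Suc j]) = p ! j" "length (map ((!) p) [i..<Suc j]) = Suc (j - i)"
    "set (map ((!) p) [i..<Suc j]) = (!) p ` {i..j}"
proof -
  show "dpath E (map ((!) p) [i..<Suc j])"
    using assms unfolding dpath_def walk_nth
    by (auto simp: distinct_map inj_on_def nth_eq_iff_index_eq simp del: upt_Suc)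
  show "hd (map ((!) p) [i..<Suc j]) = p ! i" using assms by (simp add: hd_map del: upt_Suc)
  show "last (map ((!) p) [i..<Suc j]) = p ! j" using assms by simp
  show "length (map ((!) p) [i..<Suc j]) = Suc (j - i)" using assms by simp
  show "set (map ((!) p) [i..<Suc j]) = (!) p ` {i..j}"
    by (simp add: atLeastLessThanSuc_atLeastAtMost del: upt_Suc)
qed

text \<open>
  Whatever the directions of the two chords, they and the stretches of \<open>p\<close> from \<open>a\<close> to \<open>b\<close> and from
  \<open>c\<close> to \<open>d\<close> form a spindle. The stretch from \<open>b\<close> to \<open>c\<close> may be short.
\<close>

lemma no_crossing_chords:
  assumes p: "dpath E p" and free: "spindle_free E k l" and k: "1 \<le> l" "l \<le> k"
    and a: "a + k \<le> b" "b < c" "c + k \<le> d" "d < length p"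
    and ac: "(p ! a, p ! c) \<in> E \<or> (p ! c, p ! a) \<in> E"
    and bd: "(p ! b, p ! d) \<in> E \<or> (p ! d, p ! b) \<in> E"
  shows False
proof -
  define X where "X = map ((!) p) [a..<Suc b]"
  define Y where "Y = map ((!) p) [c..<Suc d]"
  have X: "dpath E X" "hd X = p ! a" "last X = p ! b" "k < length X" "X \<noteq> []" "set X = (!) p ` {a..b}"
    using dpath_segment[OF p, of a b] a by (auto simp: X_def)
  have Y: "dpath E Y" "hd Y = p ! c" "last Y = p ! d" "k < length Y" "Y \<noteq> []" "set Y = (!) p ` {c..d}"
    using dpath_segment[OF p, of c d] a by (auto simp: Y_def)
  have inj: "p ! i = p ! j \<longleftrightarrow> i = j" if "i \<le> d" "j \<le> d" for i j
    using that a(4) p by (auto simp: dpath_def nth_eq_iff_index_eq)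
  have disj: "set X \<inter> set Y = {}" using a inj by (auto simp: X(6) Y(6))
  have in1: "p ! a \<in> set X" "p ! b \<in> set X" "p ! c \<in> set Y" "p ! d \<in> set Y"
    using a by (auto simp: X(6) Y(6))
  have out: "p ! a \<notin> set Y" "p ! b \<notin> set Y" "p ! c \<notin> set X" "p ! d \<notin> set X"
    using in1 disj by blast+
  have neq: "p ! a \<noteq> p ! d" "p ! c \<noteq> p ! d" "p ! a \<noteq> p ! b" "p ! c \<noteq> p ! b"
    using inj a k by auto
  have snoc: "dpath E (q @ [v])" if "dpath E q" "(last q, v) \<in> E" "v \<notin> set q" for q v
    using that by (auto simp: dpath_def walk_append)
  have cons: "dpath E (v # q)" if "dpath E q" "(v, hd q) \<in> E" "v \<notin> set q" for q v
    using that by (auto simp: dpath_def walk_Cons)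
  from ac bd show False
  proof (elim disjE)
    assume arcs: "(p ! a, p ! c) \<in> E" "(p ! b, p ! d) \<in> E"
    show False
    proof (rule spindle_freeD[OF free, of "X @ [p ! d]" "p ! a # Y" "p ! a" "p ! d"])
      show "dpath E (X @ [p ! d])" using X(1-3,5) arcs out neq by (intro snoc) simp_all
      show "dpath E (p ! a # Y)" using Y(1-3,5) arcs out neq by (intro cons) simp_all
      show "set (X @ [p ! d]) \<inter> set (p ! a # Y) \<subseteq> {p ! a, p ! d}" using disj out by auto
    qed (use X(2-5) Y(2-5) neq k in simp_all)
  next
    assume arcs: "(p ! a, p ! c) \<in> E" "(p ! d, p ! b) \<in> E"
    show False
    proof (rule spindle_freeD[OF free, of "X" "(p ! a # Y) @ [p ! b]" "p ! a" "p ! b"])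
      show "dpath E (X)" by (fact X(1))
      show "dpath E ((p ! a # Y) @ [p ! b])" using Y(1-3,5) arcs out neq by (intro snoc cons) simp_all
      show "set (X) \<inter> set ((p ! a # Y) @ [p ! b]) \<subseteq> {p ! a, p ! b}" using disj out by auto
    qed (use X(2-5) Y(2-5) neq k in simp_all)
  next
    assume arcs: "(p ! c, p ! a) \<in> E" "(p ! b, p ! d) \<in> E"
    show False
    proof (rule spindle_freeD[OF free, of "Y" "(p ! c # X) @ [p ! d]" "p ! c" "p ! d"])
      show "dpath E (Y)" by (fact Y(1))
      show "dpath E ((p ! c # X) @ [p ! d])" using X(1-3,5) arcs out neq by (intro snoc cons) simp_all
      show "set (Y) \<inter> set ((p ! c # X) @ [p ! d]) \<subseteq> {p ! c, p ! d}" using disj out by auto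
    qed (use X(2-5) Y(2-5) neq k in simp_all)
  next
    assume arcs: "(p ! c, p ! a) \<in> E" "(p ! d, p ! b) \<in> E"
    show False
    proof (rule spindle_freeD[OF free, of "p ! c # X" "Y @ [p ! b]" "p ! c" "p ! b"])
      show "dpath E (p ! c # X)" using X(1-3,5) arcs out neq by (intro cons) simp_all
      show "dpath E (Y @ [p ! b])" using Y(1-3,5) arcs out neq by (intro snoc) simp_all
      show "set (p ! c # X) \<inter> set (Y @ [p ! b]) \<subseteq> {p ! c, p ! b}" using disj out by auto
    qed (use X(2-5) Y(2-5) neq k in simp_all)
  qed
qed

lemma index_of:
  assumes "distinct p"
  obtains ix where "\<And>i. i < length p \<Longrightarrow> ix (p ! i) = i"
  using assms by (intro that[of "\<lambda>v. THE i. i < length p \<and> p ! i = v"] the_equality)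
    (auto simp: nth_eq_iff_index_eq)

lemma path_colouring:
  assumes p: "dpath E p" and free: "spindle_free E k l" and k: "1 \<le> l" "l \<le> k"
    and irrefl: "\<And>x. (x, x) \<notin> E"
  obtains g :: "'v \<Rightarrow> nat" where "\<And>v. g v < 3 * k"
    "\<And>u v. u \<in> set p \<Longrightarrow> v \<in> set p \<Longrightarrow> (u, v) \<in> E \<Longrightarrow> g u \<noteq> g v"
proof -
  obtain ix where ix: "\<And>i. i < length p \<Longrightarrow> ix (p ! i) = i"
    using index_of p by (auto simp: dpath_def)
  define adj where "adj i j \<longleftrightarrow> (p ! i, p ! j) \<in> E \<or> (p ! j, p ! i) \<in> E" for i j
  have "\<forall>m. \<exists>h :: nat \<Rightarrow> nat. (\<forall>a. h a < 3) \<and>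
    (\<forall>a \<in> {i. i < length p \<and> i mod k = m}. \<forall>b \<in> {i. i < length p \<and> i mod k = m}. adj a b \<longrightarrow> h a \<noteq> h b)"
  proof (intro allI crossing_free_three_colouring)
    fix m
    show "finite {i. i < length p \<and> i mod k = m}" by simp
    show "symp adj" by (auto intro: sympI simp: adj_def)
    show "irreflp adj" using irrefl by (auto intro: irreflpI simp: adj_def)
    show "crossing_free {i. i < length p \<and> i mod k = m} adj"
      unfolding crossing_free_def
    proof (intro ballI impI notI)
      fix a b c d
      assume "a \<in> {i. i < length p \<and> i mod k = m}" "b \<in> {i. i < length p \<and> i mod k = m}"
        "c \<in> {i. i < length p \<and> i mod k = m}" "d \<in> {i. i < length p \<and> i mod k = m}"
        "a < b \<and> b < c \<and> c < d" "adj a c \<and> adj b d"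
      then show False
        using no_crossing_chords[OF p free k, of a b c d] mod_eq_gap[of a b k] mod_eq_gap[of c d k]
        by (auto simp: adj_def)
    qed
  qed
  from choice[OF this] obtain h :: "nat \<Rightarrow> nat \<Rightarrow> nat" where h': "\<forall>m. (\<forall>a. h m a < 3) \<and>
    (\<forall>a \<in> {i. i < length p \<and> i mod k = m}. \<forall>b \<in> {i. i < length p \<and> i mod k = m}. adj a b \<longrightarrow> h m a \<noteq> h m b)"
    by blast
  have h: "h m a < 3" "a < length p \<Longrightarrow> b < length p \<Longrightarrow> a mod k = m \<Longrightarrow> b mod k = m \<Longrightarrow> adj a b \<Longrightarrow> h m a \<noteq> h m b"
    for m a b using spec[OF h', of m] by auto
  define g where "g v = 3 * (ix v mod k) + h (ix v mod k) (ix v)" for v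
  show ?thesis
  proof (rule that[of g])
    show "g v < 3 * k" for v
    proof -
      have "ix v mod k < k" using k by simp
      then show ?thesis using h(1)[of "ix v mod k" "ix v"] by (simp add: g_def)
    qed
    fix u v assume uv: "u \<in> set p" "v \<in> set p" "(u, v) \<in> E"
    then obtain i j where ij: "i < length p" "u = p ! i" "j < length p" "v = p ! j"
      by (metis in_set_conv_nth)
    show "g u \<noteq> g v"
    proof
      assume eq: "g u = g v"
      have gu: "g u = 3 * (i mod k) + h (i mod k) i" using ij(1) by (simp add: g_def ij(2) ix)
      have gv: "g v = 3 * (j mod k) + h (j mod k) j" using ij(3) by (simp add: g_def ij(4) ix)
      have gu3: "g u div 3 = i mod k" using h(1)[of "i mod k" i] by (simp add: gu)
      have gv3: "g v div 3 = j mod k" using h(1)[of "j mod k" j] by (simp add: gv)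
      have same: "i mod k = j mod k" using gu3 gv3 unfolding eq by (rule trans[OF sym])
      have "adj i j" using uv(3) ij by (simp add: adj_def)
      then have "h (i mod k) i \<noteq> h (i mod k) j" by (rule h(2)[OF ij(1,3) refl same[symmetric]])
      moreover have "h (j mod k) i = h (j mod k) j" using eq unfolding gu gv same by simp
      ultimately show False unfolding same by simp
    qed
  qed
qed

text \<open>
  If one block may be a single arc, then no arc \<open>(u, v)\<close> can be bypassed by a path with \<open>k\<close> or more arcs.
  So on the cycle the way from \<open>u\<close> to \<open>v\<close> has fewer than \<open>k\<close> arcs. If it does not pass the head of \<open>Z\<close>,
  then \<open>u\<close> and \<open>v\<close> have different positions modulo \<open>k\<close>; otherwise the position of \<open>v\<close>
  is less than \<open>k\<close>. The positions \<open>1, \<dots>, k - 1\<close> get colours of their own.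
\<close>

lemma cycle_colouring_short_block:
  assumes Z: "dcycle E Z" and free: "spindle_free E k 1" and k: "2 \<le> k"
  obtains g :: "'v \<Rightarrow> nat" where "\<And>v. g v < 2 * k - 1"
    "\<And>u v. u \<in> set (tl Z) \<Longrightarrow> v \<in> set (tl Z) \<Longrightarrow> (u, v) \<in> E \<Longrightarrow> u \<noteq> v \<Longrightarrow> g u \<noteq> g v"
proof -
  define n where "n = length Z"
  have Zp: "dpath E Z" "distinct Z" "Z \<noteq> []" "(last Z, hd Z) \<in> E"
    using Z by (auto simp: dcycle_def dpath_def)
  obtain ix where ix: "\<And>i. i < length Z \<Longrightarrow> ix (Z ! i) = i"
    using index_of Zp(2) by blast
  have arc: "dpath E [Z ! i, Z ! j]" if "(Z ! i, Z ! j) \<in> E" "i < n" "j < n" "i \<noteq> j" for i j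
    using that Zp(2) by (simp add: dpath_def walk_Cons n_def nth_eq_iff_index_eq)
  have forward: False if "(Z ! i, Z ! j) \<in> E" "i + k \<le> j" "j < n" for i j
    using dpath_segment[OF Zp(1), of i j] arc[OF that(1)] that k Zp(2)
    by (intro spindle_freeD[OF free dpath_segment(1)[OF Zp(1), of i j] arc[OF that(1)], of "Z ! i" "Z ! j"])
      (auto simp: n_def nth_eq_iff_index_eq simp del: upt_Suc)
  have backward: False if "(Z ! i, Z ! j) \<in> E" "k \<le> j" "j < i" "i < n" for i j
  proof -
    let ?X = "map ((!) Z) [i..<Suc (n - 1)]" and ?Y = "map ((!) Z) [0..<Suc j]"
    have X: "dpath E ?X" "hd ?X = Z ! i" "last ?X = Z ! (n - 1)" "set ?X = (!) Z ` {i..n - 1}"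
      using dpath_segment[OF Zp(1), of i "n - 1"] that by (auto simp: n_def simp del: upt_Suc)
    have Y: "dpath E ?Y" "hd ?Y = Z ! 0" "last ?Y = Z ! j" "length ?Y = Suc j" "set ?Y = (!) Z ` {0..j}"
      using dpath_segment[OF Zp(1), of 0 j] that by (auto simp: n_def simp del: upt_Suc)
    have "set ?X \<inter> set ?Y = {}"
      unfolding X(4) Y(5) using that Zp(2) by (auto simp: n_def nth_eq_iff_index_eq)
    moreover have "(Z ! (n - 1), Z ! 0) \<in> E"
      using Zp(3,4) by (simp add: last_conv_nth hd_conv_nth n_def)
    moreover have ne: "?X \<noteq> []" "?Y \<noteq> []" using that by auto
    ultimately have XY: "dpath E (?X @ ?Y)"
      using X(1,3) Y(1,2) by (simp add: dpath_def walk_append del: upt_Suc)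
    show False
    proof (rule spindle_freeD[OF free XY arc[OF that(1)], of "Z ! i" "Z ! j"])
      show "hd (?X @ ?Y) = Z ! i" "last (?X @ ?Y) = Z ! j"
        using ne X(2) Y(3) by (simp_all only: hd_append last_append if_False)
      show "k < length (?X @ ?Y)" using Y(4) that by (simp del: upt_Suc)
    qed (use that Zp(2) in \<open>auto simp: n_def nth_eq_iff_index_eq simp del: upt_Suc\<close>)
  qed
  define g where "g v = (if ix v < k then ix v - 1 else k - 1 + ix v mod k)" for v
  show ?thesis
  proof (rule that[of g])
    show "g v < 2 * k - 1" for v
    proof -
      define m where "m = ix v mod k"
      have "m < k" using k by (simp add: m_def)
      then show ?thesis using k unfolding g_def m_def[symmetric] by auto
    qed
    fix u v assume uv: "u \<in> set (tl Z)" "v \<in> set (tl Z)" "(u, v) \<in> E" "u \<noteq> v"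
    have "\<exists>i. 1 \<le> i \<and> i < n \<and> w = Z ! i" if "w \<in> set (tl Z)" for w
    proof -
      obtain i where "i < length (tl Z)" "w = tl Z ! i" using \<open>w \<in> set (tl Z)\<close> by (metis in_set_conv_nth)
      then show ?thesis by (intro exI[of _ "Suc i"]) (auto simp: nth_tl n_def)
    qed
    from this[OF uv(1)] this[OF uv(2)]
    obtain i j where ij: "1 \<le> i" "i < n" "u = Z ! i" "1 \<le> j" "j < n" "v = Z ! j"
      by blast
    have ixs: "ix u = i" "ix v = j" using ix ij by (auto simp: n_def)
    have "i \<noteq> j" using uv(4) ij by auto
    show "g u \<noteq> g v"
    proof
      assume eq: "g u = g v"
      have m: "i mod k < k" "j mod k < k" using k by auto
      consider "i < k" "j < k" | "k \<le> i" "k \<le> j" "i mod k = j mod k"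
        using eq m ij unfolding g_def ixs by (cases "i < k"; cases "j < k") auto
      then show False
      proof cases
        case 1
        then show ?thesis using eq ij \<open>i \<noteq> j\<close> unfolding g_def ixs by auto
      next
        case 2
        show ?thesis
          using forward[of i j] backward[of i j] mod_eq_gap[of i j k] uv(3) ij 2 \<open>i \<noteq> j\<close> by (cases "i < j") auto
      qed
    qed
  qed
qed

section \<open>Colouring strong spindle-free digraphs\<close>

lemma cycle_colouring:
  assumes Z: "dcycle E Z" "2 \<le> length Z" and free: "spindle_free E k l"
    and k: "1 \<le> l" "l \<le> k" "3 \<le> k" and irrefl: "\<And>x. (x, x) \<notin> E"
  shows "\<exists>g :: 'v \<Rightarrow> nat. (\<forall>v. g v < (if l = 1 then 2 * k - 1 else 3 * k)) \<and>
    (\<forall>u \<in> set (tl Z). \<forall>v \<in> set (tl Z). (u, v) \<in> E \<longrightarrow> g u \<noteq> g v)"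
proof (cases "l = 1")
  case True
  obtain g :: "'v \<Rightarrow> nat" where g: "\<And>v. g v < 2 * k - 1"
    "\<And>u v. u \<in> set (tl Z) \<Longrightarrow> v \<in> set (tl Z) \<Longrightarrow> (u, v) \<in> E \<Longrightarrow> u \<noteq> v \<Longrightarrow> g u \<noteq> g v"
    by (rule cycle_colouring_short_block[OF Z(1), of k]) (use free True k in auto)
  have "g u \<noteq> g v" if "u \<in> set (tl Z)" "v \<in> set (tl Z)" "(u, v) \<in> E" for u v
    using g(2)[OF that] that(3) irrefl by auto
  with g(1) True show ?thesis by auto
next
  case False
  have "dpath E (tl Z)"
    using Z by (cases Z; cases "tl Z") (auto simp: dcycle_def dpath_def walk_Cons)
  from path_colouring[OF this free k(1,2) irrefl]
  obtain g :: "'v \<Rightarrow> nat" where g: "\<And>v. g v < 3 * k"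
    "\<And>u v. u \<in> set (tl Z) \<Longrightarrow> v \<in> set (tl Z) \<Longrightarrow> (u, v) \<in> E \<Longrightarrow> g u \<noteq> g v"
    by blast
  then show ?thesis using False by (intro exI[of _ g]) simp
qed

context rooted_cactus
begin

lemma colouring:
  assumes free: "spindle_free E k l" and L: "2 * k - 1 \<le> L" and k: "1 \<le> l" "l \<le> k" "3 \<le> k"
    and irrefl: "\<And>x. (x, x) \<notin> E"
  shows "\<exists>g :: 'v \<Rightarrow> nat \<times> nat \<times> nat.
    (\<forall>v. g v \<in> {..<l + 1} \<times> {..<if l = 1 then 1 else 2} \<times> {..<if l = 1 then 2 * k - 1 else 3 * k}) \<and>
    (\<forall>x \<in> P. \<forall>y \<in> P. (x, y) \<in> E \<longrightarrow> g x \<noteq> g y)"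
proof -
  define N where "N = (if l = 1 then 2 * k - 1 else 3 * k)"
  have N: "0 < N" using k by (simp add: N_def)
  have "\<forall>Z. \<exists>g :: 'v \<Rightarrow> nat. (\<forall>v. g v < N) \<and> (dcycle E Z \<and> 2 \<le> length Z \<longrightarrow>
    (\<forall>u \<in> set (tl Z). \<forall>v \<in> set (tl Z). (u, v) \<in> E \<longrightarrow> g u \<noteq> g v))"
  proof
    fix Z
    show "\<exists>g :: 'v \<Rightarrow> nat. (\<forall>v. g v < N) \<and> (dcycle E Z \<and> 2 \<le> length Z \<longrightarrow>
      (\<forall>u \<in> set (tl Z). \<forall>v \<in> set (tl Z). (u, v) \<in> E \<longrightarrow> g u \<noteq> g v))"
    proof (cases "dcycle E Z \<and> 2 \<le> length Z")
      case True
      then show ?thesis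
        using cycle_colouring[OF _ _ free k irrefl, of Z] unfolding N_def by blast
    next
      case False
      then show ?thesis using N by (intro exI[of _ "\<lambda>_. 0"]) auto
    qed
  qed
  from choice[OF this] obtain h :: "'v list \<Rightarrow> 'v \<Rightarrow> nat" where h:
    "\<forall>Z. (\<forall>v. h Z v < N) \<and> (dcycle E Z \<and> 2 \<le> length Z \<longrightarrow>
      (\<forall>u \<in> set (tl Z). \<forall>v \<in> set (tl Z). (u, v) \<in> E \<longrightarrow> h Z u \<noteq> h Z v))"
    by blast
  define g where "g v = (depth v mod (l + 1), if l = 1 then 0 else if pos v < l then 1 else 0 :: nat,
    h (cyc v) v)" for v
  have range: "g v \<in> {..<l + 1} \<times> {..<if l = 1 then 1 else 2} \<times> {..<N}" for v
    using h by (simp add: g_def)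
  have proper: "g x \<noteq> g y" if xy: "x \<in> P" "y \<in> P" "(x, y) \<in> E" for x y
  proof
    assume eq: "g x = g y"
    have kk: "1 \<le> k" "l \<le> k" using k by auto
    have near: "depth a = depth b"
      if ab: "a \<in> P" "b \<in> P" "(a, b) \<in> E \<or> (b, a) \<in> E" "depth a mod (l + 1) = depth b mod (l + 1)"
        "depth a \<le> depth b" for a b
    proof (rule ccontr)
      assume ne: "depth a \<noteq> depth b"
      have "depth a + (l + 1) \<le> depth b" using ne ab(4,5) by (intro mod_eq_gap) auto
      then have "depth a + l < depth b" by simp
      from arcs_join_near_depths[OF free L k(1,2) ab(1,2) this] ab(3) show False by blast
    qed
    have d: "depth x = depth y"
      using near[of x y] near[of y x] xy eq by (cases "depth x \<le> depth y") (auto simp: g_def)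
    have "x \<noteq> y" using xy(3) irrefl by auto
    then have nr: "x \<noteq> r" "y \<noteq> r" using d root depth_Suc xy(1,2) by (metis nat.distinct(1))+
    have "cyc x = cyc y"
    proof (rule ccontr)
      assume ne: "cyc x \<noteq> cyc y"
      have ends: "(pos x < l) \<noteq> (pos y < l)"
        by (rule arcs_join_ends[OF free L kk xy(1,2) nr d ne xy(3)])
      have "1 \<le> pos x" "1 \<le> pos y"
        by (rule cyc_split[OF xy(1) nr(1)], simp) (rule cyc_split[OF xy(2) nr(2)], simp)
      then have "l \<noteq> 1" using ends by auto
      then show False using eq ends by (auto simp: g_def split: if_splits)
    qed
    moreover have "dcycle E (cyc x)" "2 \<le> length (cyc x)" "x \<in> set (tl (cyc x))" "y \<in> set (tl (cyc y))"
      using cyc(1,2,4)[OF xy(1) nr(1)] cyc(4)[OF xy(2) nr(2)] L k by auto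
    ultimately have "h (cyc x) x \<noteq> h (cyc x) y" using h xy(3) by auto
    then show False using eq \<open>cyc x = cyc y\<close> by (simp add: g_def)
  qed
  show ?thesis
    using range proper unfolding N_def by blast
qed

end

lemma nat_colouring:
  assumes "finite T" "\<And>v. g v \<in> T" "card T \<le> n"
  shows "\<exists>c :: 'v \<Rightarrow> nat. \<forall>v. c v < n \<and> (\<forall>u. g u \<noteq> g v \<longrightarrow> c u \<noteq> c v)"
proof -
  obtain f where f: "bij_betw f T {0..<card T}"
    using ex_bij_betw_finite_nat[OF assms(1)] by blast
  have "f (g v) < n" for v
    using bij_betwE[OF f] assms(2)[of v] assms(3) by (auto intro: less_le_trans[of _ "card T"])
  moreover have "f (g u) \<noteq> f (g v)" if "g u \<noteq> g v" for u v
    using f assms(2) that by (auto simp: bij_betw_def dest: inj_onD)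
  ultimately show ?thesis by (intro exI[of _ "\<lambda>v. f (g v)"]) blast
qed

text \<open>
  The common factor \<open>2 l + 2\<close> cancels for \<open>l \<ge> 2\<close>, and the claim is then an equality for \<open>k = 3\<close>,
  \<open>l = 2\<close>.
\<close>

lemma bound_arith:
  fixes k l :: nat
  assumes "1 \<le> l" "l \<le> k" "3 \<le> k"
  shows "(2 * k - 2) * ((l + 1) * ((if l = 1 then 1 else 2) * (if l = 1 then 2 * k - 1 else 3 * k)))
    \<le> (k + l - 2) * (k + l - 3) * (2 * l + 2) * (k + l + 1)"
proof -
  obtain a where a: "k = a + 3" using assms(3) by (metis le_add_diff_inverse2)
  show ?thesis
  proof (cases "l = 1")
    case True
    then show ?thesis by (simp add: a algebra_simps)
  next
    case False
    then have "2 \<le> l" using assms(1) by simp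
    then obtain b where b: "l = b + 2" by (metis le_add_diff_inverse2)
    have "3 * k * (2 * k - 2) \<le> (a + b + 3) * (a + b + 2) * (a + b + 6)"
    proof -
      have "3 * k * (2 * k - 2) = 6 * ((a + 3) * (a + 2))" by (simp add: a algebra_simps)
      also have "\<dots> \<le> (a + b + 6) * ((a + b + 3) * (a + b + 2))" by (intro mult_le_mono) auto
      finally show ?thesis by (simp add: mult.commute mult.left_commute)
    qed
    then have "(2 * l + 2) * (3 * k * (2 * k - 2)) \<le> (2 * l + 2) * ((a + b + 3) * (a + b + 2) * (a + b + 6))"
      by (rule mult_le_mono2)
    moreover have "k + l - 2 = a + b + 3" "k + l - 3 = a + b + 2" "k + l + 1 = a + b + 6"
      by (simp_all add: a b)
    ultimately show ?thesis using False by (simp add: algebra_simps)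
  qed
qed

lemma strong_spindle_free_colouring:
  assumes fin: "finite E" and irrefl: "\<And>x. (x, x) \<notin> E"
    and strong: "\<And>u v. u \<in> Field E \<Longrightarrow> v \<in> Field E \<Longrightarrow> (u, v) \<in> E\<^sup>*"
    and free: "spindle_free E k l" and k: "1 \<le> l" "l \<le> k" "3 \<le> k"
  obtains c :: "'v \<Rightarrow> nat"
  where "\<And>v. c v < (k + l - 2) * (k + l - 3) * (2 * l + 2) * (k + l + 1)"
    "\<And>u v. (u, v) \<in> E \<Longrightarrow> c u \<noteq> c v"
proof -
  define L where "L = 2 * k - 1"
  obtain K where K: "greedy E L K" "\<And>W. dcycle E W \<Longrightarrow> independent K W \<Longrightarrow> length W < L"
    by (rule maximal_greedy[OF fin, of L]) (use k in \<open>auto simp: L_def\<close>)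
  have sym: "sym (K\<^sup>*)" using greedy_sym[OF K(1)] .
  define comp where "comp v = K\<^sup>* `` {v}" for v
  define Q where "Q = {(comp x, comp y) | x y. (x, y) \<in> E \<and> (x, y) \<notin> K\<^sup>*}"
  have comp_eq: "comp x = comp y \<longleftrightarrow> (x, y) \<in> K\<^sup>*" for x y
    using sym unfolding comp_def by (auto intro: rtrancl_trans dest: symD)
  obtain q :: "'v set \<Rightarrow> nat" where q: "\<And>X. q X < 2 * k - 2" "\<And>X Y. (X, Y) \<in> Q \<Longrightarrow> q X \<noteq> q Y"
  proof (rule bondy[of Q "2 * k - 2"])
    have "Q \<subseteq> (\<lambda>(x, y). (comp x, comp y)) ` E" by (auto simp: Q_def)
    then show "finite Q" using fin by (rule finite_surj[rotated])
    show "(X, Y) \<in> Q\<^sup>*" if XY: "X \<in> Field Q" "Y \<in> Field Q" for X Y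
    proof -
      obtain x y where "x \<in> Field E" "y \<in> Field E" "X = comp x" "Y = comp y"
        using XY unfolding Q_def Field_def by blast
      moreover have "(comp x, comp z) \<in> Q\<^sup>*" if "(x, z) \<in> E\<^sup>*" for z
        using that
      proof (induction rule: rtrancl_induct)
        case (step y z)
        show ?case
        proof (cases "(y, z) \<in> K\<^sup>*")
          case True
          then show ?thesis using step.IH comp_eq by metis
        next
          case False
          then have "(comp y, comp z) \<in> Q" using step.hyps(2) by (auto simp: Q_def)
          with step.IH show ?thesis by (rule rtrancl_into_rtrancl)
        qed
      qed simp
      ultimately show ?thesis using strong by blast
    qed
    show "(X, X) \<notin> Q" for X using comp_eq by (auto simp: Q_def)
    show "length p \<le> 2 * k - 2" if "dcycle Q p" for p
    proof -
      have "length p < L"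
        by (rule quotient_has_no_long_cycle[OF K(1) free _ k(2) irrefl K(2)])
          (use that k in \<open>auto simp: L_def Q_def comp_def\<close>)
      then show ?thesis by (simp add: L_def)
    qed
    show "0 < 2 * k - 2" using k by simp
  qed blast
  define T where "T = {..<l + 1} \<times> {..<if l = 1 then 1 else 2 :: nat} \<times> {..<if l = 1 then 2 * k - 1 else 3 * k}"
  have "\<forall>r. \<exists>g. (\<forall>v. g v \<in> T) \<and> (\<forall>x \<in> comp r. \<forall>y \<in> comp r. (x, y) \<in> E \<longrightarrow> g x \<noteq> g y)"
  proof
    fix r
    obtain depth cyc where "rooted_cactus E L r (comp r) depth cyc"
      using greedy_rooted_cactus[OF K(1), of r] by (auto simp: comp_def)
    then interpret rooted_cactus E L r "comp r" depth cyc .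
    show "\<exists>g. (\<forall>v. g v \<in> T) \<and> (\<forall>x \<in> comp r. \<forall>y \<in> comp r. (x, y) \<in> E \<longrightarrow> g x \<noteq> g y)"
      unfolding T_def by (rule colouring[OF free _ k irrefl]) (simp add: L_def)
  qed
  from choice[OF this] obtain G where G:
    "\<forall>r. (\<forall>v. G r v \<in> T) \<and> (\<forall>x \<in> comp r. \<forall>y \<in> comp r. (x, y) \<in> E \<longrightarrow> G r x \<noteq> G r y)" by blast
  define rep where "rep X = (SOME v. v \<in> X)" for X :: "'v set"
  define g where "g v = (q (comp v), G (rep (comp v)) v)" for v
  have fin_range: "finite ({..<2 * k - 2} \<times> T)" by (simp add: T_def)
  have range: "g v \<in> {..<2 * k - 2} \<times> T" for v using q(1) G by (simp add: g_def)
  define B where "B = (k + l - 2) * (k + l - 3) * (2 * l + 2) * (k + l + 1)"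
  have "card ({..<2 * k - 2} \<times> T) \<le> B"
    using bound_arith[OF k] by (simp only: T_def B_def card_cartesian_product card_lessThan)
  from nat_colouring[OF fin_range range this] obtain c :: "'v \<Rightarrow> nat" where c:
    "\<forall>v. c v < B \<and> (\<forall>u. g u \<noteq> g v \<longrightarrow> c u \<noteq> c v)" ..
  have "g u \<noteq> g v" if uv: "(u, v) \<in> E" for u v
  proof (cases "(u, v) \<in> K\<^sup>*")
    case False
    then have "(comp u, comp v) \<in> Q" using uv by (auto simp: Q_def)
    then show ?thesis using q(2) by (auto simp: g_def)
  next
    case True
    then have same: "comp u = comp v" by (simp add: comp_eq)
    have "u \<in> comp u" by (simp add: comp_def)
    then have "rep (comp u) \<in> comp u" unfolding rep_def by (rule someI)
    then have "(u, rep (comp u)) \<in> K\<^sup>*" by (simp add: comp_def)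
    then have "comp (rep (comp u)) = comp u" by (simp add: comp_eq[symmetric])
    then have "u \<in> comp (rep (comp u))" "v \<in> comp (rep (comp u))"
      using same by (auto simp: comp_def)
    then have "G (rep (comp u)) u \<noteq> G (rep (comp u)) v" using G uv by blast
    then show ?thesis by (simp add: g_def same)
  qed
  then have "c u \<noteq> c v" if "(u, v) \<in> E" for u v using c that by blast
  moreover have "c v < B" for v using c by blast
  ultimately show ?thesis unfolding B_def by (rule that[rotated])
qed

section \<open>From two internally disjoint paths to a subdivision\<close>

definition arc_of :: "('a, 'b) pre_digraph \<Rightarrow> 'a \<times> 'a \<Rightarrow> 'b" where
  "arc_of D e = (SOME a. a \<in> arcs D \<and> (tail D a, head D a) = e)"

definition walk_arcs :: "('a, 'b) pre_digraph \<Rightarrow> 'a list \<Rightarrow> 'b list" where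
  "walk_arcs D s = map (arc_of D) (zip s (tl s))"

lemma arc_of:
  assumes "(x, y) \<in> arcs_ends D"
  shows "arc_of D (x, y) \<in> arcs D" "tail D (arc_of D (x, y)) = x" "head D (arc_of D (x, y)) = y"
proof -
  have "\<exists>a. a \<in> arcs D \<and> (tail D a, head D a) = (x, y)"
    using assms by (auto simp: arcs_ends_conv)
  from someI_ex[OF this]
  show "arc_of D (x, y) \<in> arcs D" "tail D (arc_of D (x, y)) = x" "head D (arc_of D (x, y)) = y"
    by (auto simp: arc_of_def)
qed

lemma set_walk_arcs: "set (walk_arcs D s) = (\<lambda>i. arc_of D (s ! i, s ! Suc i)) ` {i. Suc i < length s}"
  by (force simp: walk_arcs_def set_zip nth_tl)

lemma walk_arcs_Cons: "s \<noteq> [] \<Longrightarrow> walk_arcs D (x # s) = arc_of D (x, hd s) # walk_arcs D s"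
  by (cases s) (simp_all add: walk_arcs_def)

lemma walk_arcs_walk:
  assumes "walk (arcs_ends D) s" and H: "tail H = tail D" "head H = head D"
  shows "pre_digraph.awalk_verts H (hd s) (walk_arcs D s) = s"
    "pre_digraph.cas H (hd s) (walk_arcs D s) (last s)"
    "pre_digraph.inner_verts H (walk_arcs D s) = tl (butlast s)"
proof -
  have "pre_digraph.awalk_verts H (hd s) (walk_arcs D s) = s \<and>
      pre_digraph.cas H (hd s) (walk_arcs D s) (last s) \<and> map (tail H) (walk_arcs D s) = butlast s"
    using assms(1)
  proof (induction s)
    case (Cons x s)
    show ?case
    proof (cases "s = []")
      case True
      then show ?thesis
        by (simp add: walk_arcs_def pre_digraph.awalk_verts.simps pre_digraph.cas.simps)
    next
      case False
      then show ?thesis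
        using Cons arc_of[of x "hd s" D]
        by (simp add: walk_Cons walk_arcs_Cons pre_digraph.awalk_verts.simps pre_digraph.cas.simps H)
    qed
  qed (simp add: walk_def)
  then show "pre_digraph.awalk_verts H (hd s) (walk_arcs D s) = s"
    "pre_digraph.cas H (hd s) (walk_arcs D s) (last s)"
    "pre_digraph.inner_verts H (walk_arcs D s) = tl (butlast s)"
    by (simp_all add: pre_digraph.inner_verts_def)
qed

text \<open>
  branch
\<close>

text \<open>
  Let \<open>s\<close> be a path with more than \<open>m\<close> vertices. As a subdivision of a path with \<open>m\<close> arcs, it keeps its
  first \<open>m\<close> vertices and its last vertex as branch vertices; only the last arc is
  subdivided, by the interior. The \<open>j\<close>-th piece replaces the \<open>j\<close>-th arc.
\<close>

definition branch :: "nat \<Rightarrow> 'a list \<Rightarrow> 'a list" where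
  "branch m s = take m s @ [last s]"

definition piece :: "nat \<Rightarrow> 'a list \<Rightarrow> nat \<Rightarrow> 'a list" where
  "piece m s j = (if Suc j < m then [s ! j, s ! Suc j] else drop j s)"

definition interior :: "nat \<Rightarrow> 'a list \<Rightarrow> 'a list" where
  "interior m s = drop m (butlast s)"

lemma split_branch: "1 \<le> m \<Longrightarrow> m < length s \<Longrightarrow> s = take m s @ interior m s @ [last s]"
proof -
  assume m: "1 \<le> m" "m < length s"
  then have "s = butlast s @ [last s]" by (cases s) auto
  moreover have "butlast s = take m (butlast s) @ drop m (butlast s)" by simp
  moreover have "take m (butlast s) = take m s" using m by (simp add: take_butlast)
  ultimately show ?thesis by (metis append.assoc interior_def)
qed

lemma branch_interior:
  assumes "distinct s" "1 \<le> m" "m < length s"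
  shows "distinct (branch m s)" "set (branch m s) \<inter> set (interior m s) = {}"
    "set (branch m s) \<union> set (interior m s) = set s" "length (branch m s) = Suc m"
    "branch m s ! 0 = hd s" "branch m s ! m = last s"
proof -
  have "distinct (take m s @ interior m s @ [last s])" using assms split_branch[of m s] by simp
  then show "distinct (branch m s)" "set (branch m s) \<inter> set (interior m s) = {}"
    by (auto simp: branch_def)
  have "set s = set (take m s @ interior m s @ [last s])" using assms split_branch[of m s] by simp
  then show "set (branch m s) \<union> set (interior m s) = set s" by (auto simp: branch_def)
  show "length (branch m s) = Suc m" using assms by (simp add: branch_def)
  show "branch m s ! 0 = hd s" using assms by (cases s) (auto simp: branch_def nth_append)
  show "branch m s ! m = last s" using assms by (simp add: branch_def nth_append)
qed

lemma piece_facts: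
  assumes s: "dpath E s" and m: "j < m" "m < length s"
  shows "dpath E (piece m s j)" "hd (piece m s j) = branch m s ! j"
    "last (piece m s j) = branch m s ! Suc j" "2 \<le> length (piece m s j)"
    "tl (butlast (piece m s j)) = (if Suc j = m then interior m s else [])"
    "set (piece m s j) \<subseteq> set s"
proof -
  have w: "(s ! i, s ! Suc i) \<in> E" if "Suc i < length s" for i
    using s that by (auto simp: dpath_def walk_nth)
  have d: "distinct s" using s by (simp add: dpath_def)
  show "dpath E (piece m s j)"
    using w d m by (auto simp: piece_def dpath_def walk_nth nth_eq_iff_index_eq)
  show "hd (piece m s j) = branch m s ! j"
    using m by (simp add: piece_def branch_def nth_append hd_drop_conv_nth)
  show "last (piece m s j) = branch m s ! Suc j"
    using m by (auto simp: piece_def branch_def nth_append)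
  show "2 \<le> length (piece m s j)" using m by (auto simp: piece_def)
  show "tl (butlast (piece m s j)) = (if Suc j = m then interior m s else [])"
    using m by (auto simp: piece_def interior_def butlast_drop tl_drop drop_Suc)
  show "set (piece m s j) \<subseteq> set s" using m by (auto simp: piece_def dest: in_set_dropD)
qed

lemma walk_arcs_pieces:
  assumes "1 \<le> m" "m < length s"
  shows "(\<Union>j<m. set (walk_arcs D (piece m s j))) = set (walk_arcs D s)"
proof -
  have short: "set (walk_arcs D (piece m s j)) = {arc_of D (s ! j, s ! Suc j)}" if "Suc j < m" for j
    using that by (simp add: piece_def walk_arcs_def)
  have long: "set (walk_arcs D (piece m s j)) = (\<lambda>i. arc_of D (s ! i, s ! Suc i)) ` {i. j \<le> i \<and> Suc i < length s}"
    if "Suc j = m" for j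
  proof -
    have "{i. j \<le> i \<and> Suc i < length s} = (\<lambda>i. j + i) ` {i. Suc i < length s - j}"
    proof (intro set_eqI iffI)
      fix i assume "i \<in> {i. j \<le> i \<and> Suc i < length s}"
      then show "i \<in> (\<lambda>i. j + i) ` {i. Suc i < length s - j}" by (intro image_eqI[of _ _ "i - j"]) auto
    qed auto
    then show ?thesis using that assms by (simp add: piece_def set_walk_arcs image_image)
  qed
  obtain m' where m': "m = Suc m'" using assms(1) by (cases m) auto
  have "(\<Union>j<m. set (walk_arcs D (piece m s j))) =
      (\<Union>j<m'. {arc_of D (s ! j, s ! Suc j)}) \<union> set (walk_arcs D (piece m s m'))"
    using short by (auto simp: m' lessThan_Suc)
  also have "\<dots> = (\<lambda>i. arc_of D (s ! i, s ! Suc i)) ` ({..<m'} \<union> {i. m' \<le> i \<and> Suc i < length s})"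
    using long[of m'] m' by auto
  also have "{..<m'} \<union> {i. m' \<le> i \<and> Suc i < length s} = {i. Suc i < length s}"
    using assms m' by auto
  finally show ?thesis by (simp add: set_walk_arcs)
qed


lemma piece_gen_iapath:
  assumes s: "dpath (arcs_ends D) s" and m: "j < m" "m < length s"
    and H: "tail H = tail D" "head H = head D" "set s \<subseteq> verts H" "set (walk_arcs D s) \<subseteq> arcs H"
    and V: "set (branch m s) \<subseteq> V" "set (interior m s) \<inter> V = {}"
  shows "pre_digraph.gen_iapath H V (branch m s ! j) (walk_arcs D (piece m s j)) (branch m s ! Suc j)"
    "set (pre_digraph.inner_verts H (walk_arcs D (piece m s j))) = (if Suc j = m then set (interior m s) else {})"
proof -
  note piece = piece_facts[OF s m]
  have w: "walk (arcs_ends D) (piece m s j)" "distinct (piece m s j)"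
    using piece(1) by (auto simp: dpath_def)
  note walk = walk_arcs_walk[OF w(1) H(1,2)]
  show inner: "set (pre_digraph.inner_verts H (walk_arcs D (piece m s j))) =
      (if Suc j = m then set (interior m s) else {})"
    by (simp add: walk(3) piece(5))
  have "length (branch m s) = Suc m" using m by (simp add: branch_def)
  then have "branch m s ! j \<in> V" "branch m s ! Suc j \<in> V" using V(1) m by (auto intro!: nth_mem)
  moreover have "hd (piece m s j) \<in> verts H"
    using piece(4,6) H(3) hd_in_set[of "piece m s j"] by fastforce
  moreover have "set (walk_arcs D (piece m s j)) \<subseteq> arcs H"
    using walk_arcs_pieces[of m s D] m H(4) by fastforce
  moreover have "walk_arcs D (piece m s j) \<noteq> []"
    using piece(4) by (cases "piece m s j"; cases "tl (piece m s j)") (auto simp: walk_arcs_def)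
  ultimately show "pre_digraph.gen_iapath H V (branch m s ! j) (walk_arcs D (piece m s j)) (branch m s ! Suc j)"
    unfolding pre_digraph.gen_iapath_def pre_digraph.apath_def pre_digraph.awalk_def inner
    using walk(1,2) w(2) V(2) piece(2,3) by auto
qed

text \<open>
  The arc \<open>a i\<close> is the \<open>i\<close>-th arc of the block of length \<open>k\<close>, and \<open>b j\<close> is the \<open>j\<close>-th arc of the
  other block, both counted from the common initial vertex \<open>0\<close>. As the other block is numbered
  backwards, \<open>b 0\<close> is the arc from \<open>0\<close> to \<open>k + l - 1\<close>. The blocks share an arc only if \<open>k = l = 1\<close>.
\<close>

lemma two_block_cycle_arcs:
  fixes k l :: nat
  assumes "1 \<le> k" "1 \<le> l" "3 \<le> k + l"
  defines "a i \<equiv> (i, Suc i)" and "b j \<equiv> (Suc (k + l - Suc j) mod (k + l), k + l - Suc j)"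
  shows "parcs (two_block_cycle k l) = a ` {..<k} \<union> b ` {..<l}"
    "inj_on b {..<l}" "a ` {..<k} \<inter> b ` {..<l} = {}"
proof -
  have "{(Suc i mod (k + l), i) | i. k \<le> i \<and> i < k + l} = b ` {..<l}"
  proof (intro set_eqI iffI)
    fix e assume "e \<in> {(Suc i mod (k + l), i) | i. k \<le> i \<and> i < k + l}"
    then obtain i where "e = (Suc i mod (k + l), i)" "k \<le> i" "i < k + l" by blast
    then show "e \<in> b ` {..<l}" unfolding b_def by (intro image_eqI[of _ _ "k + l - Suc i"]) auto
  next
    fix e assume "e \<in> b ` {..<l}"
    then show "e \<in> {(Suc i mod (k + l), i) | i. k \<le> i \<and> i < k + l}"
      using assms(1) by (auto simp: b_def)
  qed
  then show "parcs (two_block_cycle k l) = a ` {..<k} \<union> b ` {..<l}"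
    by (auto simp: two_block_cycle_def a_def)
  show "inj_on b {..<l}" by (auto simp: inj_on_def b_def)
  have "a i \<noteq> b j" if "i < k" "j < l" for i j
  proof
    assume "a i = b j"
    then have eq: "i = Suc (k + l - Suc j) mod (k + l)" "Suc i = k + l - Suc j" by (auto simp: a_def b_def)
    show False
    proof (cases "j = 0")
      case True
      have "Suc (k + l - Suc 0) = k + l" using assms(3) by simp
      then show ?thesis using eq True assms(3) by simp
    next
      case False
      then have "Suc (k + l - Suc j) < k + l" using that by linarith
      then show ?thesis using eq by auto
    qed
  qed
  then show "a ` {..<k} \<inter> b ` {..<l} = {}" by blast
qed

lemma spindle_contains_subdivision:
  assumes D: "wf_digraph D"
    and p: "dpath (arcs_ends D) p" "k < length p" and q: "dpath (arcs_ends D) q" "l < length q"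
    and ends: "hd p = hd q" "last p = last q" and disj: "set p \<inter> set q \<subseteq> {hd p, last p}"
    and kl: "1 \<le> k" "1 \<le> l" "3 \<le> k + l"
  shows "contains_subdivision_of D (with_proj (two_block_cycle k l))"
proof -
  define a :: "nat \<Rightarrow> nat \<times> nat" where "a i = (i, Suc i)" for i
  define b where "b j = (Suc (k + l - Suc j) mod (k + l), k + l - Suc j)" for j
  note arcs = two_block_cycle_arcs[OF kl, folded a_def b_def]
  define H where "H = \<lparr>verts = set p \<union> set q, arcs = set (walk_arcs D p) \<union> set (walk_arcs D q),
    tail = tail D, head = head D\<rparr>"
  \<comment> \<open>The vertices \<open>k + 1, \<dots>, k + l - 1\<close> of the two-block cycle run backwards along the second block.\<close>
  define f where "f i = (if i \<le> k then branch k p ! i else branch l q ! (k + l - i))" for i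
  define S where "S e = (if e \<in> a ` {..<k} then piece k p (fst e) else piece l q (k + l - Suc (snd e)))" for e
  note bp = branch_interior[OF _ kl(1) p(2)] and bq = branch_interior[OF _ kl(2) q(2)]
  have dist: "distinct p" "distinct q" using p(1) q(1) by (auto simp: dpath_def)
  have f_k: "f k = last q" "f 0 = hd q" using bp(5,6)[OF dist(1)] ends by (auto simp: f_def)
  have f_b: "f (k + l - j) = branch l q ! j" if "1 \<le> j" "j \<le> l" for j
  proof (cases "j = l")
    case True
    then show ?thesis using bq(6)[OF dist(2)] f_k by simp
  next
    case False
    then have "k < k + l - j" "k + l - (k + l - j) = j" using that by linarith+
    then show ?thesis by (simp add: f_def)
  qed
  have f_arc_a: "f (fst (a i)) = branch k p ! i" "f (snd (a i)) = branch k p ! Suc i" if "i < k" for i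
    using that by (simp_all add: a_def f_def)
  have f_arc_b: "f (fst (b j)) = branch l q ! j" "f (snd (b j)) = branch l q ! Suc j" if "j < l" for j
  proof -
    show "f (snd (b j)) = branch l q ! Suc j" using f_b[of "Suc j"] that by (simp add: b_def)
    show "f (fst (b j)) = branch l q ! j"
    proof (cases "j = 0")
      case True
      have "Suc (k + l - Suc 0) = k + l" using kl by simp
      then show ?thesis using True f_k(2) bq(5)[OF dist(2)] by (simp add: b_def)
    next
      case False
      then have "Suc (k + l - Suc j) = k + l - j" "k + l - j < k + l" using that by linarith+
      then show ?thesis using f_b[of j] that False by (simp add: b_def)
    qed
  qed
  have S_a: "S (a i) = piece k p i" if "i < k" for i using that by (auto simp: S_def a_def)
  have S_b: "S (b j) = piece l q j" if "j < l" for j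
  proof -
    have "b j \<notin> a ` {..<k}" using arcs(3) that by blast
    then show ?thesis using that by (simp add: S_def b_def)
  qed
  define V where "V = f ` {0..<k + l}"
  have V: "V = set (branch k p) \<union> set (branch l q)"
  proof (intro equalityI subsetI)
    fix v assume "v \<in> V"
    then obtain i where i: "i < k + l" "v = f i" by (auto simp: V_def)
    then show "v \<in> set (branch k p) \<union> set (branch l q)"
      using bp(4)[OF dist(1)] bq(4)[OF dist(2)] by (auto simp: f_def intro!: nth_mem)
  next
    fix v assume "v \<in> set (branch k p) \<union> set (branch l q)"
    then consider i where "i \<le> k" "v = branch k p ! i" | j where "j \<le> l" "v = branch l q ! j"
      using bp(4)[OF dist(1)] bq(4)[OF dist(2)] by (auto simp: in_set_conv_nth less_Suc_eq_le)
    then show "v \<in> V"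
    proof cases
      case 1
      then have "v = f i" by (simp add: f_def)
      then show ?thesis using 1 kl unfolding V_def by auto
    next
      case 2
      show ?thesis
      proof (cases "j = 0")
        case True
        then have "v = f 0" using 2 f_k bq(5)[OF dist(2)] by simp
        then show ?thesis using kl unfolding V_def by auto
      next
        case False
        then have "v = f (k + l - j)" using 2 f_b by simp
        then show ?thesis using kl False unfolding V_def by auto
      qed
    qed
  qed
  have common: "{hd p, last p} \<subseteq> set (branch k p)" "{hd p, last p} \<subseteq> set (branch l q)"
  proof -
    have "branch k p ! 0 \<in> set (branch k p)" "branch k p ! k \<in> set (branch k p)"
      "branch l q ! 0 \<in> set (branch l q)" "branch l q ! l \<in> set (branch l q)"
      using bp(4)[OF dist(1)] bq(4)[OF dist(2)] by (auto intro!: nth_mem)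
    then show "{hd p, last p} \<subseteq> set (branch k p)" "{hd p, last p} \<subseteq> set (branch l q)"
      using bp(5,6)[OF dist(1)] bq(5,6)[OF dist(2)] ends by auto
  qed
  have sub: "set (branch k p) \<subseteq> set p" "set (interior k p) \<subseteq> set p"
    "set (branch l q) \<subseteq> set q" "set (interior l q) \<subseteq> set q"
    using bp(3)[OF dist(1)] bq(3)[OF dist(2)] by auto
  have int_p: "set (interior k p) \<inter> set q = {}"
    using bp(2)[OF dist(1)] sub(2) common(1) disj by blast
  have int_q: "set (interior l q) \<inter> set p = {}"
    using bq(2)[OF dist(2)] sub(4) common(2) disj by blast
  have int: "set (interior k p) \<inter> V = {}" "set (interior l q) \<inter> V = {}"
    "set (interior k p) \<inter> set (interior l q) = {}"
    using bp(2)[OF dist(1)] bq(2)[OF dist(2)] int_p int_q sub(1,3,4) by (auto simp: V)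
  have inj: "inj_on f {0..<k + l}"
  proof -
    have nth_p: "branch k p ! i = branch k p ! i' \<longleftrightarrow> i = i'" if "i \<le> k" "i' \<le> k" for i i'
      using that bp(1,4)[OF dist(1)] by (simp add: nth_eq_iff_index_eq)
    have nth_q: "branch l q ! j = branch l q ! j' \<longleftrightarrow> j = j'" if "j \<le> l" "j' \<le> l" for j j'
      using that bq(1,4)[OF dist(2)] by (simp add: nth_eq_iff_index_eq)
    have mixed: "branch k p ! i \<noteq> branch l q ! j" if "i \<le> k" "0 < j" "j < l" for i j
    proof
      assume eq: "branch k p ! i = branch l q ! j"
      have "branch k p ! i \<in> set (branch k p)" "branch l q ! j \<in> set (branch l q)"
        using that bp(4)[OF dist(1)] bq(4)[OF dist(2)] by (auto intro!: nth_mem)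
      then have "branch k p ! i \<in> set p" "branch l q ! j \<in> set q" using sub by blast+
      then have "branch l q ! j \<in> {hd q, last q}" using eq disj ends by auto
      then show False
        using nth_q[of j 0] nth_q[of j l] that bq(5,6)[OF dist(2)] by auto
    qed
    show ?thesis
    proof (rule inj_onI)
      fix i i' assume i: "i \<in> {0..<k + l}" "i' \<in> {0..<k + l}" "f i = f i'"
      consider "i \<le> k" "i' \<le> k" | "i \<le> k" "k < i'" | "k < i" "i' \<le> k" | "k < i" "k < i'" by linarith
      then show "i = i'"
      proof cases
        case 1
        then show ?thesis using i nth_p by (simp add: f_def)
      next
        case 2
        then have "0 < k + l - i'" "k + l - i' < l" using i(2) by auto
        then show ?thesis using i(3) 2 mixed[of i "k + l - i'"] by (simp add: f_def)
      next
        case 3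
        then have "0 < k + l - i" "k + l - i < l" using i(1) by auto
        then show ?thesis using i(3) 3 mixed[of i' "k + l - i"] by (simp add: f_def)
      next
        case 4
        then show ?thesis using i nth_q[of "k + l - i" "k + l - i'"] by (simp add: f_def)
      qed
    qed
  qed
  have H: "tail H = tail D" "head H = head D" "set p \<subseteq> verts H" "set q \<subseteq> verts H"
    "set (walk_arcs D p) \<subseteq> arcs H" "set (walk_arcs D q) \<subseteq> arcs H"
    by (auto simp: H_def)
  have Vb: "set (branch k p) \<subseteq> V" "set (branch l q) \<subseteq> V" using V by auto
  note path_a = piece_gen_iapath[OF p(1) _ p(2) H(1,2,3,5) Vb(1) int(1)]
  note path_b = piece_gen_iapath[OF q(1) _ q(2) H(1,2,4,6) Vb(2) int(2)]
  let ?inner = "\<lambda>e. set (pre_digraph.inner_verts H (walk_arcs D (S e)))"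
  have inner_a: "?inner (a i) = (if Suc i = k then set (interior k p) else {})" if "i < k" for i
    using path_a(2)[of i] that by (simp add: S_a)
  have inner_b: "?inner (b j) = (if Suc j = l then set (interior l q) else {})" if "j < l" for j
    using path_b(2)[of j] that by (simp add: S_b)
  have "is_subdivision_of H (with_proj (two_block_cycle k l))"
    unfolding is_subdivision_of_def
  proof (intro exI[of _ f] exI[of _ "\<lambda>e. walk_arcs D (S e)"] conjI)
    let ?F = "with_proj (two_block_cycle k l) :: (nat, nat \<times> nat) pre_digraph"
    have F: "verts ?F = {0..<k + l}" "arcs ?F = a ` {..<k} \<union> b ` {..<l}"
      using arcs(1) by (simp_all add: two_block_cycle_def)
    show "inj_on f (verts ?F)" using inj F by simp
    show "\<forall>e \<in> arcs ?F. pre_digraph.gen_iapath H (f ` verts ?F) (f (tail ?F e)) (walk_arcs D (S e)) (f (head ?F e))"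
      unfolding F V_def[symmetric]
      using path_a(1) path_b(1) by (auto simp: f_arc_a f_arc_b S_a S_b)
    show "\<forall>e \<in> arcs ?F. \<forall>e' \<in> arcs ?F. e \<noteq> e' \<longrightarrow> ?inner e \<inter> ?inner e' = {}"
      unfolding F
    proof (intro ballI impI equals0I)
      fix e e' x
      assume e: "e \<in> a ` {..<k} \<union> b ` {..<l}" "e' \<in> a ` {..<k} \<union> b ` {..<l}" "e \<noteq> e'"
        and x: "x \<in> ?inner e \<inter> ?inner e'"
      have only: "e = a (k - 1) \<and> x \<in> set (interior k p) \<or> e = b (l - 1) \<and> x \<in> set (interior l q)"
        if "e \<in> a ` {..<k} \<union> b ` {..<l}" "x \<in> ?inner e" for e
        using that(1)
      proof
        assume "e \<in> a ` {..<k}"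
        then obtain i where "i < k" "e = a i" by blast
        then show ?thesis using that(2) inner_a[of i] by (cases "Suc i = k") auto
      next
        assume "e \<in> b ` {..<l}"
        then obtain j where "j < l" "e = b j" by blast
        then show ?thesis using that(2) inner_b[of j] by (cases "Suc j = l") auto
      qed
      have "x \<notin> set (interior k p) \<or> x \<notin> set (interior l q)" using int(3) by blast
      then show False using only[of e] only[of e'] e x by blast
    qed
    have in_a: "(\<Union>i<k. ?inner (a i)) = set (interior k p)"
    proof (intro equalityI UN_least)
      show "?inner (a i) \<subseteq> set (interior k p)" if "i \<in> {..<k}" for i
        using inner_a[of i] that by simp
      have "k - 1 \<in> {..<k}" "?inner (a (k - 1)) = set (interior k p)"
        using inner_a[of "k - 1"] kl(1) by simp_all
      then show "set (interior k p) \<subseteq> (\<Union>i<k. ?inner (a i))" by blast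
    qed
    have in_b: "(\<Union>j<l. ?inner (b j)) = set (interior l q)"
    proof (intro equalityI UN_least)
      show "?inner (b j) \<subseteq> set (interior l q)" if "j \<in> {..<l}" for j
        using inner_b[of j] that by simp
      have "l - 1 \<in> {..<l}" "?inner (b (l - 1)) = set (interior l q)"
        using inner_b[of "l - 1"] kl(2) by simp_all
      then show "set (interior l q) \<subseteq> (\<Union>j<l. ?inner (b j))" by blast
    qed
    have "(\<Union>e \<in> arcs ?F. ?inner e) = set (interior k p) \<union> set (interior l q)"
      unfolding F in_a[symmetric] in_b[symmetric] by (simp only: UN_Un image_UN image_image SUP_image o_def)
    moreover have "verts H = (set (branch k p) \<union> set (interior k p)) \<union> (set (branch l q) \<union> set (interior l q))"
      by (simp add: H_def bp(3)[OF dist(1)] bq(3)[OF dist(2)])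
    ultimately show "verts H = f ` verts ?F \<union> (\<Union>e \<in> arcs ?F. ?inner e)"
      unfolding F(1) V_def[symmetric] V by (simp only: Un_ac)
    have arcs_a: "(\<Union>i<k. set (walk_arcs D (S (a i)))) = set (walk_arcs D p)"
      using walk_arcs_pieces[OF kl(1) p(2), of D] by (simp add: S_a)
    have arcs_b: "(\<Union>j<l. set (walk_arcs D (S (b j)))) = set (walk_arcs D q)"
      using walk_arcs_pieces[OF kl(2) q(2), of D] by (simp add: S_b)
    have "arcs H = set (walk_arcs D p) \<union> set (walk_arcs D q)" by (simp add: H_def)
    then show "arcs H = (\<Union>e \<in> arcs ?F. set (walk_arcs D (S e)))"
      unfolding F arcs_a[symmetric] arcs_b[symmetric] by (simp only: UN_Un SUP_image o_def)
  qed
  moreover have "subgraph H D"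
  proof (rule subgraphI)
    have ends_in: "e \<in> arcs D \<and> tail D e \<in> set s \<and> head D e \<in> set s"
      if "e \<in> set (walk_arcs D s)" "dpath (arcs_ends D) s" for e s
      using that arc_of(1-3)[of _ _ D] by (auto simp: set_walk_arcs dpath_def walk_nth)
    show "arcs H \<subseteq> arcs D" using ends_in p(1) q(1) by (auto simp: H_def)
    have verts: "set s \<subseteq> verts D" if s: "dpath (arcs_ends D) s" "1 < length s" for s
    proof
      fix v assume "v \<in> set s"
      then obtain i where i: "i < length s" "v = s ! i" by (auto simp: in_set_conv_nth)
      have arc: "(s ! i, s ! Suc i) \<in> arcs_ends D" if "Suc i < length s" for i
        using s that by (auto simp: dpath_def walk_nth)
      have "\<exists>w. (v, w) \<in> arcs_ends D \<or> (w, v) \<in> arcs_ends D"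
        using arc[of i] arc[of "i - 1"] i s(2) by (cases "Suc i < length s"; cases i) auto
      then show "v \<in> verts D"
        using wf_digraph.tail_in_verts[OF D] wf_digraph.head_in_verts[OF D] by (auto simp: arcs_ends_conv)
    qed
    have "1 < length p" "1 < length q" using p(2) q(2) kl by auto
    then show "verts H \<subseteq> verts D" using verts p(1) q(1) by (simp add: H_def)
    show "compatible D H" by (simp add: compatible_def H_def)
    show "wf_digraph H"
      using ends_in p(1) q(1) by unfold_locales (auto simp: H_def)
    show "wf_digraph D" by (fact D)
  qed
  ultimately show ?thesis unfolding contains_subdivision_of_def by blast
qed

theorem theorem23:
  fixes k l :: nat and D :: "('a, 'b) pre_digraph"
  assumes "1 \<le> k" and "1 \<le> l" and "max l 3 \<le> k"
    and "digraph D" and "strongly_connected D"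
    and "\<not> contains_subdivision_of D (with_proj (two_block_cycle k l))"
  shows "digraph_chromatic_number D \<le> (k + l - 2) * (k + l - 3) * (2 * l + 2) * (k + l + 1)"
proof -
  interpret digraph D by fact
  define B where "B = (k + l - 2) * (k + l - 3) * (2 * l + 2) * (k + l + 1)"
  have kl: "1 \<le> l" "l \<le> k" "3 \<le> k" using assms by auto
  have "finite (arcs_ends D)" by (simp add: arcs_ends_conv)
  moreover have "(x, x) \<notin> arcs_ends D" for x using no_loops by (auto simp: arcs_ends_conv)
  moreover have "(u, v) \<in> (arcs_ends D)\<^sup>*" if "u \<in> Field (arcs_ends D)" "v \<in> Field (arcs_ends D)" for u v
  proof -
    have "u \<in> verts D" "v \<in> verts D" using that by (auto simp: Field_def arcs_ends_conv)
    then have "u \<rightarrow>\<^sup>*\<^bsub>D\<^esub> v" using assms(5) by (simp add: strongly_connected_def)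
    then show ?thesis unfolding reachable_def by (rule rtrancl_on_rtranclI)
  qed
  moreover have "spindle_free (arcs_ends D) k l"
    unfolding spindle_free_def
  proof (rule notI, elim exE conjE)
    fix p q
    assume "dpath (arcs_ends D) p" "dpath (arcs_ends D) q" "hd p = hd q" "last p = last q"
      "set p \<inter> set q \<subseteq> {hd p, last p}" "k < length p" "l < length q"
    then have "contains_subdivision_of D (with_proj (two_block_cycle k l))"
      using assms(1,2) kl by (intro spindle_contains_subdivision[of D p k q l] wf_digraph_axioms) auto
    with assms(6) show False by blast
  qed
  ultimately obtain c :: "'a \<Rightarrow> nat" where c: "\<And>v. c v < B" "\<And>u v. (u, v) \<in> arcs_ends D \<Longrightarrow> c u \<noteq> c v"
    unfolding B_def using strong_spindle_free_colouring[OF _ _ _ _ kl] by metis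
  have "proper_colouring (with_proj (mk_symmetric D)) B c"
    unfolding proper_colouring_def
  proof (intro conjI ballI allI impI)
    show "c v < B" for v by (rule c(1))
    fix u v assume "u \<rightarrow>\<^bsub>with_proj (mk_symmetric D)\<^esub> v"
    then have "(u, v) \<in> arcs_ends D \<or> (v, u) \<in> arcs_ends D"
      by (auto simp: parcs_mk_symmetric arcs_ends_conv)
    then show "c u \<noteq> c v" using c(2) by metis
  qed
  then show ?thesis
    unfolding digraph_chromatic_number_def chromatic_number_def B_def by (intro Least_le) blast
qed

end
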